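(* Let $\Gamma$ be a finite $\Phi_d$-complex with associated invariant $d$-simplex $\sigma=\{v_0,\dots,v_d\}$, and let $K$ be a finite pure $d$-dimensional simplicial complex. If $m$ is even and $Coind_{\mathbb{Z}_2}(Hom(\Gamma,K))\geq m$, then $\chi(K)\geq m+d+2$.
   Context: Perspectivities, projectivities and groups of projectivities: two $d$-simplices are adjacent if they share a $(d-1)$-face $\tau$; the perspectivity between them is the unique simplicial bijection fixing $\tau$ pointwise; a projectivity is a composition of perspectivities along a sequence of consecutively adjacent $d$-simplices; $\Pi(\Gamma,\sigma)$ is the group of projectivities from $\sigma$ to itself. A pure $d$-dimensional simplicial complex $\Gamma$ is a $\Phi_d$-complex if it carries a simplicial involution $\omega:\Gamma\to\Gamma$ (a $\mathbb{Z}_2$-action) with an invariant $d$-simplex $\sigma$ such that the restriction $\omega|_\sigma$ is a non-trivial element of $\Pi(\Gamma,\sigma)$. For finite simplicial complexes $A,L$, $Hom(A,L)$ is the cell complex contained in $\prod_{v\in V(A)}\Delta^{V(L)}$ whose cells are $\prod_{v\in V(A)}\Delta^{\eta(v)}$, indexed by functions $\eta:V(A)\to 2^{V(L)}\setminus\{\emptyset\}$ such that (1) $\eta(u)\cap\eta(v)=\emptyset$ whenever $u\neq v$ and $\{u,v\}\in A$, and (2) for each simplex $\rho\in A$, every set containing at most one element from each $\eta(v)$, $v\in\rho$, is a simplex of $L$. The involution $\omega$ induces the involution $\eta\mapsto\eta\circ\omega$ on $Hom(\Gamma,K)$. $Coind_{\mathbb{Z}_2}(X)\geq m$ means there exists a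 $\mathbb{Z}_2$-equivariant map $S^m\to X$, with $S^m$ carrying the antipodal action. The chromatic number $\chi(K)$ is the least $n$ such that there is a non-degenerated (injective on simplices) simplicial map from $K$ to the simplex $\Delta^{[n]}$ with vertex set $\{1,\dots,n\}$. *)

theory Defs
  imports "HOL-Analysis.Analysis" "HOL-Algebra.Bij"
begin

section \<open>Abstract simplicial complexes\<close>

text \<open>
  The empty simplex, of dimension \<open>-1\<close>, belongs to every complex. A \<open>d\<close>-simplex is a simplex with
  \<open>d + 1\<close> elements.
\<close>

definition abstract_complex :: "'a set set \<Rightarrow> bool" where
  "abstract_complex K \<longleftrightarrow>
     {} \<in> K \<and> (\<forall>s\<in>K. finite s) \<and> (\<forall>s\<in>K. \<forall>t. t \<subseteq> s \<longrightarrow> t \<in> K)"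

definition vertex_set :: "'a set set \<Rightarrow> 'a set" where
  "vertex_set K = \<Union>K"

definition simplices :: "nat \<Rightarrow> 'a set set \<Rightarrow> 'a set set" where
  "simplices d K = {s \<in> K. finite s \<and> card s = d + 1}"

definition pure_complex :: "nat \<Rightarrow> 'a set set \<Rightarrow> bool" where
  "pure_complex d K \<longleftrightarrow>
     abstract_complex K \<and> (\<forall>s\<in>K. card s \<le> d + 1) \<and> (\<forall>s\<in>K. \<exists>t\<in>simplices d K. s \<subseteq> t)"

definition simplicial_vertex_map :: "'a set set \<Rightarrow> 'b set set \<Rightarrow> ('a \<Rightarrow> 'b) \<Rightarrow> bool" where
  "simplicial_vertex_map K L f \<longleftrightarrow> (\<forall>s\<in>K. f ` s \<in> L)"

definition nondegenerate_on :: "'a set set \<Rightarrow> ('a \<Rightarrow> 'b) \<Rightarrow> bool" where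
  "nondegenerate_on K f \<longleftrightarrow> (\<forall>s\<in>K. inj_on f s)"

text \<open>
  The simplex with vertex set \<open>{1, \<dots>, n}\<close> is the complex of all subsets of \<open>{1..n}\<close>. A finite
  complex always admits a map as below for some \<open>n\<close>.
\<close>

definition chromatic_number :: "'a set set \<Rightarrow> nat" where
  "chromatic_number K =
     (LEAST n. \<exists>f. simplicial_vertex_map K (Pow {1..n}) f \<and> nondegenerate_on K f)"

section \<open>Projectivities\<close>

text \<open>
  Maps between simplices are represented extensionally. Every bijection between two simplices is
  simplicial. If two \<open>d\<close>-simplices have exactly \<open>d\<close> common vertices, the common \<open>(d - 1)\<close>-face is
  their intersection.
\<close>

definition adjacent :: "nat \<Rightarrow> 'a set set \<Rightarrow> 'a set \<Rightarrow> 'a set \<Rightarrow> bool" where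
  "adjacent d K s t \<longleftrightarrow> s \<in> simplices d K \<and> t \<in> simplices d K \<and> card (s \<inter> t) = d"

definition perspectivity :: "nat \<Rightarrow> 'a set set \<Rightarrow> 'a set \<Rightarrow> 'a set \<Rightarrow> ('a \<Rightarrow> 'a) \<Rightarrow> bool" where
  "perspectivity d K s t p \<longleftrightarrow>
     adjacent d K s t \<and> p \<in> extensional s \<and> bij_betw p s t \<and> (\<forall>v\<in>s \<inter> t. p v = v)"

lemma perspectivity_unique:
  assumes "adjacent d K s t"
  shows "\<exists>!p. perspectivity d K s t p"
proof -
  have fin: "finite s" "finite t" and card: "card s = d + 1" "card t = d + 1" "card (s \<inter> t) = d"
    using assms by (auto simp: adjacent_def simplices_def)
  have "card (s - t) = 1" "card (t - s) = 1"
    using fin card by (simp_all add: card_Diff_subset_Int Int_commute)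
  then obtain a b where a: "s - t = {a}" and b: "t - s = {b}"
    by (auto simp: card_1_singleton_iff)
  let ?p = "\<lambda>v\<in>s. if v = a then b else v"
  have "perspectivity d K s t ?p"
    unfolding perspectivity_def
  proof (intro conjI)
    show "bij_betw ?p s t"
      by (rule bij_betw_byWitness[where f' = "\<lambda>v. if v = b then a else v"]) (use a b in auto)
  qed (use assms a in auto)
  moreover have "q = ?p" if q: "perspectivity d K s t q" for q
  proof
    fix v
    have img: "q ` s = t" and inj: "inj_on q s" and fixed: "\<forall>v\<in>s \<inter> t. q v = v"
      and ext: "q \<in> extensional s"
      using q by (auto simp: perspectivity_def bij_betw_def)
    have "q a \<in> t" using img a by blast
    moreover have "q a \<notin> s"
    proof
      assume "q a \<in> s"
      then have "q (q a) = q a" using fixed \<open>q a \<in> t\<close> by blast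
      then have "q a = a" using inj \<open>q a \<in> s\<close> a by (auto simp: inj_on_def)
      then show False using \<open>q a \<in> t\<close> a by auto
    qed
    ultimately have "q a = b" using b by blast
    then show "q v = ?p v" using fixed ext a by (auto simp: extensional_def)
  qed
  ultimately show ?thesis by blast
qed

inductive projectivity :: "nat \<Rightarrow> 'a set set \<Rightarrow> 'a set \<Rightarrow> 'a set \<Rightarrow> ('a \<Rightarrow> 'a) \<Rightarrow> bool"
  for d K where
  projectivity_id: "s \<in> simplices d K \<Longrightarrow> projectivity d K s s (\<lambda>v\<in>s. v)"
| projectivity_step: "projectivity d K s t f \<Longrightarrow> perspectivity d K t u p \<Longrightarrow>
    projectivity d K s u (compose s p f)"

definition projectivity_group :: "nat \<Rightarrow> 'a set set \<Rightarrow> 'a set \<Rightarrow> ('a \<Rightarrow> 'a) monoid" where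
  "projectivity_group d K s = (BijGroup s)\<lparr>carrier := {f. projectivity d K s s f}\<rparr>"

lemma projectivity_simplices:
  "projectivity d K s t f \<Longrightarrow> s \<in> simplices d K \<and> t \<in> simplices d K \<and> f \<in> extensional s \<and> bij_betw f s t"
proof (induction rule: projectivity.induct)
  case (projectivity_id s)
  then show ?case by (simp add: bij_betw_def inj_on_def extensional_def)
next
  case (projectivity_step s t f u p)
  then show ?case
    by (auto simp: perspectivity_def adjacent_def intro: bij_betw_compose)
qed

lemma projectivity_compose:
  assumes "projectivity d K t u g" "projectivity d K s t f"
  shows "projectivity d K s u (compose s g f)"
  using assms
proof (induction arbitrary: s f rule: projectivity.induct)
  case (projectivity_id t)
  have "compose s (\<lambda>v\<in>t. v) f = f"
    using projectivity_simplices[OF projectivity_id(2)]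
    by (auto simp: compose_def fun_eq_iff extensional_def bij_betw_def)
  then show ?case using projectivity_id by metis
next
  case (projectivity_step t u g w p)
  have "compose s (compose t p g) f = compose s p (compose s g f)"
    using projectivity_simplices[OF projectivity_step.prems]
    by (auto simp: compose_def fun_eq_iff bij_betw_def)
  then show ?case
    using projectivity.projectivity_step[OF projectivity_step.IH[OF projectivity_step.prems]]
      projectivity_step.hyps by metis
qed

lemma projectivity_inverse:
  assumes "projectivity d K s t f"
  shows "\<exists>g. projectivity d K t s g \<and> compose s g f = (\<lambda>v\<in>s. v)"
  using assms
proof (induction rule: projectivity.induct)
  case (projectivity_id s)
  then show ?case
    by (intro exI[of _ "\<lambda>v\<in>s. v"] conjI projectivity.projectivity_id)
      (auto simp: compose_def fun_eq_iff)
next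
  case (projectivity_step s t f u p)
  then obtain g where g: "projectivity d K t s g" "compose s g f = (\<lambda>v\<in>s. v)" by blast
  have p: "adjacent d K t u" "bij_betw p t u" "\<forall>v\<in>t \<inter> u. p v = v"
    using projectivity_step by (auto simp: perspectivity_def)
  define q where "q = restrict (inv_into t p) u"
  have inv: "inv_into t p (p v) = v" if "v \<in> t" for v
    using p that by (simp add: bij_betw_inv_into_left)
  have qp: "q (p v) = v" if "v \<in> t" for v
    using p that inv by (auto simp: q_def bij_betw_def)
  have "bij_betw q u t"
    unfolding q_def using p by (simp add: bij_betw_inv_into)
  moreover have "q v = v" if "v \<in> u \<inter> t" for v
    using qp[of v] p(3) that by auto
  ultimately have "perspectivity d K u t q"
    using p by (auto simp: perspectivity_def adjacent_def q_def Int_commute)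
  moreover have "u \<in> simplices d K" using p by (auto simp: adjacent_def)
  ultimately have "projectivity d K u t (compose u q (\<lambda>v\<in>u. v))"
    by (blast intro: projectivity.intros)
  moreover have "compose u q (\<lambda>v\<in>u. v) = q"
    by (auto simp: compose_def q_def fun_eq_iff)
  ultimately have "projectivity d K u s (compose u g q)"
    using projectivity_compose[OF g(1)] by metis
  moreover have "compose s (compose u g q) (compose s p f) = (\<lambda>v\<in>s. v)"
  proof
    fix v
    have "f v \<in> t" if "v \<in> s"
      using projectivity_simplices[OF projectivity_step.hyps(1)] that by (auto simp: bij_betw_def)
    then show "compose s (compose u g q) (compose s p f) v = (\<lambda>v\<in>s. v) v"
      using qp p(2) fun_cong[OF g(2), of v] by (auto simp: compose_def bij_betw_def)
  qed
  ultimately show ?case by blast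
qed

lemma group_projectivity_group:
  assumes "s \<in> simplices d K"
  shows "group (projectivity_group d K s)"
proof -
  have bij: "f \<in> Bij s" if "projectivity d K s s f" for f
    using projectivity_simplices[OF that] by (simp add: Bij_def)
  have ext: "f \<in> extensional s" "f ` s = s" if "projectivity d K s s f" for f
    using projectivity_simplices[OF that] by (auto simp: bij_betw_def)
  show ?thesis
  proof (rule groupI)
    fix f assume "f \<in> carrier (projectivity_group d K s)"
    then have f: "projectivity d K s s f" by (simp add: projectivity_group_def)
    then obtain g where g: "projectivity d K s s g" "compose s g f = (\<lambda>v\<in>s. v)"
      using projectivity_inverse by blast
    then show "\<exists>g\<in>carrier (projectivity_group d K s).
        g \<otimes>\<^bsub>projectivity_group d K s\<^esub> f = \<one>\<^bsub>projectivity_group d K s\<^esub>"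
      using f by (intro bexI[of _ g]) (simp_all add: projectivity_group_def BijGroup_def bij)
    show "\<one>\<^bsub>projectivity_group d K s\<^esub> \<otimes>\<^bsub>projectivity_group d K s\<^esub> f = f"
      using f ext[OF f] bij[OF f]
      by (auto simp: projectivity_group_def BijGroup_def id_Bij compose_def fun_eq_iff extensional_def)
  next
    fix f g h
    assume "f \<in> carrier (projectivity_group d K s)" "g \<in> carrier (projectivity_group d K s)"
      "h \<in> carrier (projectivity_group d K s)"
    then have "f \<in> carrier (BijGroup s)" "g \<in> carrier (BijGroup s)" "h \<in> carrier (BijGroup s)"
      by (simp_all add: projectivity_group_def BijGroup_def bij)
    then show "f \<otimes>\<^bsub>projectivity_group d K s\<^esub> g \<otimes>\<^bsub>projectivity_group d K s\<^esub> h =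
        f \<otimes>\<^bsub>projectivity_group d K s\<^esub> (g \<otimes>\<^bsub>projectivity_group d K s\<^esub> h)"
      using monoid.m_assoc[OF group.is_monoid[OF group_BijGroup]]
      by (simp add: projectivity_group_def)
  qed (use assms in \<open>auto simp: projectivity_group_def BijGroup_def bij
        intro: projectivity_compose projectivity_id\<close>)
qed

text \<open>
  Only the restriction of \<open>\<omega>\<close> to the vertex set is relevant.
\<close>

definition simplicial_involution :: "'a set set \<Rightarrow> ('a \<Rightarrow> 'a) \<Rightarrow> bool" where
  "simplicial_involution K \<omega> \<longleftrightarrow>
     simplicial_vertex_map K K \<omega> \<and> (\<forall>v\<in>vertex_set K. \<omega> (\<omega> v) = v)"

definition Phi_complex :: "nat \<Rightarrow> 'a set set \<Rightarrow> ('a \<Rightarrow> 'a) \<Rightarrow> 'a set \<Rightarrow> bool" where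
  "Phi_complex d K \<omega> s \<longleftrightarrow>
     pure_complex d K \<and> simplicial_involution K \<omega> \<and> s \<in> simplices d K \<and> \<omega> ` s = s \<and>
     restrict \<omega> s \<in> carrier (projectivity_group d K s) - {\<one>\<^bsub>projectivity_group d K s\<^esub>}"

section \<open>Hom complexes\<close>

text \<open>
  The geometric simplex on a finite set \<open>S\<close> is given by barycentric coordinates, extended by
  \<open>0\<close> outside \<open>S\<close>. Thus the simplex on a subset of \<open>S\<close> is literally a face of the simplex on \<open>S\<close>.
\<close>

definition geometric_simplex :: "'b set \<Rightarrow> ('b \<Rightarrow> real) set" where
  "geometric_simplex S = {x. (\<forall>i. 0 \<le> x i) \<and> (\<forall>i. i \<notin> S \<longrightarrow> x i = 0) \<and> sum x S = 1}"

definition geometric_simplex_topology :: "'b set \<Rightarrow> ('b \<Rightarrow> real) topology" where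
  "geometric_simplex_topology S = subtopology (powertop_real UNIV) (geometric_simplex S)"

definition Hom_indices :: "'a set set \<Rightarrow> 'b set set \<Rightarrow> ('a \<Rightarrow> 'b set) set" where
  "Hom_indices A L =
     {\<eta> \<in> vertex_set A \<rightarrow>\<^sub>E (Pow (vertex_set L) - {{}}).
        (\<forall>u\<in>vertex_set A. \<forall>v\<in>vertex_set A. u \<noteq> v \<and> {u, v} \<in> A \<longrightarrow> \<eta> u \<inter> \<eta> v = {}) \<and>
        (\<forall>\<rho>\<in>A. \<forall>T. T \<subseteq> (\<Union>v\<in>\<rho>. \<eta> v) \<and>
           (\<forall>v\<in>\<rho>. \<forall>x\<in>T \<inter> \<eta> v. \<forall>y\<in>T \<inter> \<eta> v. x = y) \<longrightarrow> T \<in> L)}"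

definition Hom_cell :: "'a set set \<Rightarrow> ('a \<Rightarrow> 'b set) \<Rightarrow> ('a \<Rightarrow> 'b \<Rightarrow> real) set" where
  "Hom_cell A \<eta> = (\<Pi>\<^sub>E v\<in>vertex_set A. geometric_simplex (\<eta> v))"

definition Hom_complex :: "'a set set \<Rightarrow> 'b set set \<Rightarrow> ('a \<Rightarrow> 'b \<Rightarrow> real) topology" where
  "Hom_complex A L =
     subtopology
       (product_topology (\<lambda>v. geometric_simplex_topology (vertex_set L)) (vertex_set A))
       (\<Union>\<eta>\<in>Hom_indices A L. Hom_cell A \<eta>)"

text \<open>
  The induced involution is precomposition with \<open>\<omega>\<close> on the points. It maps the cell of \<open>\<eta>\<close>
  to the cell of \<open>\<eta> \<circ> \<omega>\<close>, as shown below.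
\<close>

definition Hom_involution :: "'a set set \<Rightarrow> ('a \<Rightarrow> 'a) \<Rightarrow> ('a \<Rightarrow> 'c) \<Rightarrow> 'a \<Rightarrow> 'c" where
  "Hom_involution A \<omega> x = (\<lambda>v\<in>vertex_set A. x (\<omega> v))"

lemma Hom_involution_cell:
  assumes "abstract_complex A" "simplicial_involution A \<omega>"
  shows "Hom_involution A \<omega> ` Hom_cell A \<eta> = Hom_cell A (Hom_involution A \<omega> \<eta>)"
proof -
  have V: "\<omega> v \<in> vertex_set A" "\<omega> (\<omega> v) = v" if "v \<in> vertex_set A" for v
    using assms that
    by (auto simp: simplicial_involution_def simplicial_vertex_map_def vertex_set_def)
  have *: "Hom_involution A \<omega> x \<in> Hom_cell A (Hom_involution A \<omega> \<zeta>)" if "x \<in> Hom_cell A \<zeta>"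
    for x :: "'a \<Rightarrow> 'b \<Rightarrow> real" and \<zeta>
    using that V by (auto simp: Hom_involution_def Hom_cell_def PiE_iff)
  have inv: "Hom_involution A \<omega> (Hom_involution A \<omega> x) = x" if "x \<in> extensional (vertex_set A)"
    for x :: "'a \<Rightarrow> 'c"
    using that V by (auto simp: Hom_involution_def extensional_def fun_eq_iff)
  have cell: "Hom_cell A (Hom_involution A \<omega> (Hom_involution A \<omega> \<eta>)) = Hom_cell A \<eta>"
    using V by (auto simp: Hom_cell_def Hom_involution_def intro!: PiE_cong)
  show ?thesis
  proof
    show "Hom_cell A (Hom_involution A \<omega> \<eta>) \<subseteq> Hom_involution A \<omega> ` Hom_cell A \<eta>"
    proof
      fix y assume y: "y \<in> Hom_cell A (Hom_involution A \<omega> \<eta>)"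
      then have "Hom_involution A \<omega> y \<in> Hom_cell A \<eta>"
        using *[OF y] cell by simp
      moreover have "y = Hom_involution A \<omega> (Hom_involution A \<omega> y)"
        using y V by (auto simp: Hom_cell_def Hom_involution_def PiE_iff extensional_def fun_eq_iff)
      ultimately show "y \<in> Hom_involution A \<omega> ` Hom_cell A \<eta>" by blast
    qed
  qed (use * in blast)
qed

section \<open>Coindex\<close>

text \<open>
  \<open>coind_ge X \<tau> m\<close> states that the coindex of the space \<open>X\<close> with involution \<open>\<tau>\<close> is at least \<open>m\<close>.
\<close>

definition coind_ge :: "'x topology \<Rightarrow> ('x \<Rightarrow> 'x) \<Rightarrow> nat \<Rightarrow> bool" where
  "coind_ge X \<tau> m \<longleftrightarrow>
     (\<exists>f. continuous_map (nsphere m) X f \<and>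
        (\<forall>x\<in>topspace (nsphere m). f (\<lambda>i. - x i) = \<tau> (f x)))"

end

theory Submission
  imports Defs "HOL-Homology.Homology"
begin

text \<open>
  Suppose \<open>K\<close> has a colouring with \<open>m + d + 1\<close> colours. It turns an equivariant map
  \<open>S\<^sup>m \<rightarrow> Hom(\<Gamma>, K)\<close> into one to \<open>Hom(\<Gamma>, \<Delta>)\<close>, where \<open>\<Delta>\<close> is the simplex of colours; restrict it to \<open>\<sigma>\<close>.
  Since \<open>Hom(\<sigma>, \<Delta>)\<close> has dimension \<open>m\<close> and \<open>\<omega>\<close> acts freely on it, signed sums over the cells of each
  dimension define an equivariant map from it to \<open>S\<^sup>m\<close>, and the composite \<open>q : S\<^sup>m \<rightarrow> S\<^sup>m\<close> is odd. By
  Borsuk's theorem \<open>q\<close> has odd degree. Along a perspectivity only one vertex moves, from a row of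
  colour weights to another row compatible with all the fixed ones, so a straight-line homotopy shows
  that \<open>q\<close> is unchanged up to homotopy by parallel transport. As \<open>\<omega>\<close> on \<open>\<sigma>\<close> is a projectivity,
  \<open>q\<close> is homotopic to \<open>- q\<close>, whose degree is \<open>- deg q\<close> for even \<open>m\<close>; hence \<open>deg q = 0\<close>.

  For Borsuk's theorem, an odd map is approximated by an odd Lipschitz map. The image of the equator
  then misses a direction, so the map deforms through odd maps to one preserving the equator, and
  the degrees modulo 2 are compared inductively.
\<close>

section \<open>Self-maps of spheres\<close>

text \<open>Points of \<open>nsphere n\<close> are infinite sequences vanishing beyond
  \<open>n\<close>, hence the cutoff. Where \<open>v\<close> vanishes up to \<open>n\<close>,
  division by zero gives the zero sequence, which is off the sphere; so continuity below needs a
  nonvanishing hypothesis.\<close>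

definition normalized :: "nat \<Rightarrow> (nat \<Rightarrow> real) \<Rightarrow> nat \<Rightarrow> real" where
  "normalized n v = (\<lambda>i. if i \<le> n then v i / L2_set v {..n} else 0)"

lemma topspace_nsphere_iff:
  "x \<in> topspace (nsphere n) \<longleftrightarrow> (\<Sum>i\<le>n. (x i)\<^sup>2) = 1 \<and> (\<forall>i>n. x i = 0)"
  by (simp add: nsphere)

lemma L2_set_nsphere: "x \<in> topspace (nsphere n) \<Longrightarrow> L2_set x {..n} = 1"
  by (simp add: topspace_nsphere_iff L2_set_def)

lemma topspace_nsphere_uminus: "x \<in> topspace (nsphere n) \<Longrightarrow> (\<lambda>i. - x i) \<in> topspace (nsphere n)"
  by (simp add: topspace_nsphere_iff)

lemma topspace_nsphere_nonzero: "x \<in> topspace (nsphere n) \<Longrightarrow> \<exists>i\<le>n. x i \<noteq> 0"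
  by (rule ccontr) (simp add: topspace_nsphere_iff)

lemma topspace_nsphere_abs_le_1: "x \<in> topspace (nsphere n) \<Longrightarrow> \<bar>x i\<bar> \<le> 1"
  using topspace_nsphere_1 abs_square_le_1 by blast

text \<open>All spheres lie in one sequence space, so the equator is literally the lower sphere, and
  a map preserving it can serve unchanged as a self-map of both spheres.\<close>

lemma topspace_nsphere_Suc:
  "x \<in> topspace (nsphere (Suc n)) \<and> x (Suc n) = 0 \<longleftrightarrow> x \<in> topspace (nsphere n)"
  by (auto simp: topspace_nsphere_iff Suc_lessI) (metis Suc_lessI)

lemma L2_set_pos: "\<exists>i\<le>n. v i \<noteq> 0 \<Longrightarrow> L2_set v {..n::nat} > 0"
  by (metis L2_set_eq_0_iff L2_set_nonneg atMost_iff finite_atMost order_less_le)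

lemma normalized_in_nsphere:
  assumes "\<exists>i\<le>n. v i \<noteq> 0"
  shows "normalized n v \<in> topspace (nsphere n)"
proof -
  have p: "L2_set v {..n} > 0" using assms by (rule L2_set_pos)
  have "(\<Sum>i\<le>n. (v i)\<^sup>2) = (L2_set v {..n})\<^sup>2"
    by (simp add: L2_set_def sum_nonneg)
  then show ?thesis
    using p by (simp add: topspace_nsphere_iff normalized_def power_divide flip: sum_divide_distrib)
qed

lemma normalized_nsphere: "x \<in> topspace (nsphere n) \<Longrightarrow> normalized n x = x"
  by (auto simp: normalized_def L2_set_nsphere fun_eq_iff topspace_nsphere_iff)

lemma normalized_uminus: "normalized n (\<lambda>i. - v i) = (\<lambda>i. - normalized n v i)"
  by (auto simp: normalized_def L2_set_def fun_eq_iff)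

lemma continuous_map_into_nsphere:
  "continuous_map X (nsphere n) f \<longleftrightarrow>
     (\<forall>i. continuous_map X euclideanreal (\<lambda>x. f x i)) \<and> (\<forall>x\<in>topspace X. f x \<in> topspace (nsphere n))"
  unfolding nsphere continuous_map_in_subtopology continuous_map_componentwise_UNIV by auto

lemma continuous_map_nsphere_antipodal: "continuous_map (nsphere n) (nsphere n) (\<lambda>x i. - x i)"
  unfolding continuous_map_into_nsphere
  using continuous_map_minus[OF continuous_map_nsphere_projection[of n]]
  by (simp add: topspace_nsphere_uminus)

lemma continuous_map_normalized:
  assumes "\<And>i. i \<le> n \<Longrightarrow> continuous_map X euclideanreal (\<lambda>x. a x i)"
    and "\<And>x. x \<in> topspace X \<Longrightarrow> \<exists>i\<le>n. a x i \<noteq> 0"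
  shows "continuous_map X (nsphere n) (\<lambda>x. normalized n (a x))"
  unfolding continuous_map_into_nsphere
proof (intro conjI allI ballI)
  fix i
  have "continuous_map X euclideanreal (\<lambda>x. a x i / L2_set (a x) {..n})" if "i \<le> n"
  proof -
    have "continuous_map X euclideanreal (\<lambda>x. L2_set (a x) {..n})"
      unfolding L2_set_def by (intro continuous_intros assms) auto
    moreover have "L2_set (a x) {..n} \<noteq> 0" if "x \<in> topspace X" for x
      using L2_set_pos[OF assms(2)[OF that]] by simp
    ultimately show ?thesis using assms(1) that by (intro continuous_map_real_divide) auto
  qed
  then show "continuous_map X euclideanreal (\<lambda>x. normalized n (a x) i)"
    by (cases "i \<le> n") (simp_all add: normalized_def)
qed (use assms normalized_in_nsphere in blast)

text \<open>Normalizing a nowhere zero homotopy keeps it on the sphere, where degree is homotopy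
  invariant. The deformations below can thus be written linearly, leaving only nonvanishing to
  check.\<close>

lemma Brouwer_degree2_normalized_homotopy:
  assumes cont: "\<And>i. i \<le> n \<Longrightarrow>
      continuous_map (prod_topology (top_of_set {0..1::real}) (nsphere n)) euclideanreal
        (\<lambda>z. H (fst z) (snd z) i)"
    and nz: "\<And>t x. 0 \<le> t \<Longrightarrow> t \<le> 1 \<Longrightarrow> x \<in> topspace (nsphere n) \<Longrightarrow> \<exists>i\<le>n. H t x i \<noteq> 0"
  shows "Brouwer_degree2 n (\<lambda>x. normalized n (H 0 x)) = Brouwer_degree2 n (\<lambda>x. normalized n (H 1 x))"
proof (rule Brouwer_degree2_homotopic)
  have "continuous_map (prod_topology (top_of_set {0..1::real}) (nsphere n)) (nsphere n)
     (\<lambda>z. normalized n (H (fst z) (snd z)))"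
    by (rule continuous_map_normalized) (use cont nz in auto)
  then show "homotopic_with (\<lambda>x. True) (nsphere n) (nsphere n)
      (\<lambda>x. normalized n (H 0 x)) (\<lambda>x. normalized n (H 1 x))"
    unfolding homotopic_with_def by (intro exI[of _ "\<lambda>z. normalized n (H (fst z) (snd z))"]) auto
qed

lemma continuous_map_snd_comp:
  "continuous_map Y Z f \<Longrightarrow> continuous_map (prod_topology X Y) Z (\<lambda>z. f (snd z))"
  using continuous_map_compose[OF continuous_map_snd, of Y Z f] by (simp add: o_def)

lemma continuous_map_fst_real:
  "continuous_map (prod_topology (top_of_set S) Y) euclideanreal (\<lambda>z. fst z)"
  by (rule continuous_map_into_fulltopology[OF continuous_map_fst])

lemma Brouwer_degree2_normalized_segment:
  assumes a: "\<And>i. i \<le> n \<Longrightarrow> continuous_map (nsphere n) euclideanreal (\<lambda>x. a x i)"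
    and b: "\<And>i. i \<le> n \<Longrightarrow> continuous_map (nsphere n) euclideanreal (\<lambda>x. b x i)"
    and nz: "\<And>t x. 0 \<le> t \<Longrightarrow> t \<le> 1 \<Longrightarrow> x \<in> topspace (nsphere n) \<Longrightarrow>
       \<exists>i\<le>n. (1 - t) * a x i + t * b x i \<noteq> 0"
  shows "Brouwer_degree2 n (\<lambda>x. normalized n (a x)) = Brouwer_degree2 n (\<lambda>x. normalized n (b x))"
proof -
  have "Brouwer_degree2 n (\<lambda>x. normalized n (\<lambda>i. (1 - 0) * a x i + 0 * b x i)) =
        Brouwer_degree2 n (\<lambda>x. normalized n (\<lambda>i. (1 - 1) * a x i + 1 * b x i))"
    by (rule Brouwer_degree2_normalized_homotopy[of n "\<lambda>t x i. (1 - t) * a x i + t * b x i"])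
       (use nz in \<open>auto intro!: continuous_intros continuous_map_fst_real a b
          continuous_map_snd_comp[of "nsphere n" _ "\<lambda>x. a x _"] continuous_map_snd_comp[of "nsphere n" _ "\<lambda>x. b x _"]\<close>)
  then show ?thesis by simp
qed

section \<open>Degree of the antipodal map on even-dimensional spheres\<close>

lemma Brouwer_degree2_antipodal:
  assumes "even n"
  shows "Brouwer_degree2 n (\<lambda>x i. - x i) = -1"
proof -
  let ?S = "topspace (nsphere n)"
  txt \<open>
    The antipodal map agrees with the reflection up to half a turn in each of the coordinate planes
    \<open>(1, 2), \<dots>, (n - 1, n)\<close>; the quarter turn \<open>q\<close> is joined to both by a straight segment.
  \<close>
  define r where "r = (\<lambda>(x :: nat \<Rightarrow> real) i. if i = 0 then - x i else x i)"
  define q where "q = (\<lambda>(x :: nat \<Rightarrow> real) i. if i = 0 then - x i else if odd i then - x (Suc i) else x (i - 1))"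
  define u where "u = (\<lambda>(x :: nat \<Rightarrow> real) i. - x i)"
  have proj: "continuous_map (nsphere n) euclideanreal (\<lambda>x. x k)" for k
    by (rule continuous_map_nsphere_projection)
  have c: "continuous_map (nsphere n) euclideanreal (\<lambda>x. r x i)"
    "continuous_map (nsphere n) euclideanreal (\<lambda>x. q x i)"
    "continuous_map (nsphere n) euclideanreal (\<lambda>x. u x i)" for i
    unfolding r_def q_def u_def by (auto intro!: continuous_intros proj)
  \<comment> \<open>The two equations form a linear system in \<open>x\<close> and \<open>y\<close>
    with determinant \<open>s\<^sup>2 + t\<^sup>2\<close>.\<close>
  have pair: "x = 0 \<and> y = 0" if "s * x = t * y" "s * y = - (t * x)" "s \<noteq> 0 \<or> t \<noteq> 0" for x y s t :: real
  proof -
    have "t * x = - (s * y)" using that(2) by simp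
    have "(s\<^sup>2 + t\<^sup>2) * x = s * (s * x) + t * (t * x)"
      by (simp add: algebra_simps power2_eq_square)
    also have "\<dots> = 0" unfolding \<open>t * x = _\<close> that(1) by simp
    finally have "(s\<^sup>2 + t\<^sup>2) * x = 0" .
    moreover have "(s\<^sup>2 + t\<^sup>2) * y = s * (s * y) + t * (t * y)"
      by (simp add: algebra_simps power2_eq_square)
    then have "(s\<^sup>2 + t\<^sup>2) * y = 0" unfolding that(2) that(1)[symmetric] by simp
    moreover have "s\<^sup>2 + t\<^sup>2 \<noteq> 0" using that(3) by (simp add: sum_power2_eq_zero_iff)
    ultimately show ?thesis by (metis mult_eq_0_iff)
  qed
  have rot: "x j = 0" if "0 < j" "j \<le> n" "s \<noteq> 0 \<or> t \<noteq> 0"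
    and z: "\<And>i. 0 < i \<Longrightarrow> i \<le> n \<Longrightarrow> s * x i + t * q x i = 0"
    for x :: "nat \<Rightarrow> real" and s t j
  proof -
    \<comment> \<open>The odd index of the coordinate plane containing \<open>j\<close>. As
      \<open>n\<close> is even, its partner \<open>Suc i\<close> does not exceed
      \<open>n\<close>.\<close>
    define i where "i = (if odd j then j else j - 1)"
    have i: "odd i" "Suc i \<le> n" "j = i \<or> j = Suc i" "0 < i"
      using \<open>0 < j\<close> \<open>j \<le> n\<close> assms by (auto simp: i_def) presburger+
    have "x i = 0 \<and> x (Suc i) = 0"
      by (rule pair[of s _ t]) (use z[of i] z[of "Suc i"] i that(3) in \<open>auto simp: q_def\<close>)
    then show ?thesis using i by auto
  qed
  have "Brouwer_degree2 n (\<lambda>x. normalized n (r x)) = Brouwer_degree2 n (\<lambda>x. normalized n (q x))"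
  proof (rule Brouwer_degree2_normalized_segment[OF c(1,2)])
    fix t :: real and x assume t: "0 \<le> t" "t \<le> 1" and x: "x \<in> ?S"
    show "\<exists>i\<le>n. (1 - t) * r x i + t * q x i \<noteq> 0"
    proof (rule ccontr)
      assume *: "\<not> ?thesis"
      \<comment> \<open>Coordinate 0 equals \<open>- x 0\<close> at both ends of the segment, hence
        throughout it.\<close>
      have "x 0 = 0" using * by (auto simp: q_def r_def algebra_simps dest: spec[of _ 0])
      moreover have "(1 - t) * x i + t * q x i = 0" if "0 < i" "i \<le> n" for i
        using * that by (auto simp: r_def dest: spec[of _ i])
      then have "x j = 0" if "0 < j" "j \<le> n" for j
        using rot[of j "1 - t" t x] that by simp
      ultimately have "x j = 0" if "j \<le> n" for j using that by (cases "j = 0") auto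
      then show False using topspace_nsphere_nonzero[OF x] by auto
    qed
  qed
  also have "\<dots> = Brouwer_degree2 n (\<lambda>x. normalized n (u x))"
  proof (rule Brouwer_degree2_normalized_segment[OF c(2,3)])
    fix t :: real and x assume t: "0 \<le> t" "t \<le> 1" and x: "x \<in> ?S"
    show "\<exists>i\<le>n. (1 - t) * q x i + t * u x i \<noteq> 0"
    proof (rule ccontr)
      assume *: "\<not> ?thesis"
      have "x 0 = 0" using * by (auto simp: q_def u_def algebra_simps dest: spec[of _ 0])
      moreover have "- t * x i + (1 - t) * q x i = 0" if "0 < i" "i \<le> n" for i
        using * that by (auto simp: u_def algebra_simps dest: spec[of _ i])
      then have "x j = 0" if "0 < j" "j \<le> n" for j
        using rot[of j "- t" "1 - t" x] that by simp
      ultimately have "x j = 0" if "j \<le> n" for j using that by (cases "j = 0") auto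
      then show False using topspace_nsphere_nonzero[OF x] by auto
    qed
  qed
  also have "\<dots> = Brouwer_degree2 n u"
    by (rule Brouwer_degree2_eq) (simp add: u_def normalized_nsphere topspace_nsphere_uminus)
  finally show ?thesis
    using Brouwer_degree2_eq[of n "\<lambda>x. normalized n (r x)" r] Brouwer_degree2_reflection[of n]
      continuous_map_nsphere_reflection[of n 0]
    unfolding r_def u_def continuous_map_into_nsphere by (auto simp: normalized_nsphere)
qed

section \<open>Degrees of odd maps\<close>

lemma nsphere_eq_top_of_set: "nsphere n = top_of_set (topspace (nsphere n))"
  by (simp add: nsphere euclidean_product_topology)

text \<open>By Tychonoff the cube of all sequences in \<open>[-1, 1]\<close> is compact, and the
  sphere is a closed subset of it.\<close>

lemma compact_topspace_nsphere: "compact (topspace (nsphere n))"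
proof -
  have "compactin (powertop_real UNIV) (Pi\<^sub>E UNIV (\<lambda>i. {-1..1}))"
    by (simp add: compactin_PiE)
  then have box: "compact (Pi\<^sub>E (UNIV :: nat set) (\<lambda>i. {-1..1 :: real}))"
    by (simp add: euclidean_product_topology)
  have "closed ({x :: nat \<Rightarrow> real. (\<Sum>i\<le>n. (x i)\<^sup>2) = 1} \<inter> (\<Inter>i\<in>{n<..}. {x. x i = 0}))"
    by (intro closed_Int closed_INT ballI closed_Collect_eq continuous_on_const continuous_on_sum
        continuous_on_power continuous_on_product_coordinates)
  moreover have "topspace (nsphere n) = {x. (\<Sum>i\<le>n. (x i)\<^sup>2) = 1} \<inter> (\<Inter>i\<in>{n<..}. {x. x i = 0})"
    by (auto simp: topspace_nsphere_iff)
  ultimately have "closed (topspace (nsphere n))" by simp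
  moreover have "x \<in> Pi\<^sub>E UNIV (\<lambda>i. {-1..1})" if "x \<in> topspace (nsphere n)" for x
    using topspace_nsphere_abs_le_1[OF that] by (auto simp: abs_le_iff minus_le_iff)
  then have "Pi\<^sub>E UNIV (\<lambda>i. {-1..1}) \<inter> topspace (nsphere n) = topspace (nsphere n)" by blast
  ultimately show ?thesis using compact_Int_closed[OF box] by metis
qed

text \<open>Stone-Weierstrass applied to the algebra \<open>P\<close> of functions that are
  Lipschitz for the sum-of-absolute-values distance; the coordinates separate points.\<close>

lemma Lipschitz_approximation_nsphere:
  assumes "continuous_map (nsphere n) euclideanreal h" "0 < e"
  obtains g L where "continuous_map (nsphere n) euclideanreal g"
    "\<And>x. x \<in> topspace (nsphere n) \<Longrightarrow> \<bar>h x - g x\<bar> < e" "0 \<le> L"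
    "\<And>x y. x \<in> topspace (nsphere n) \<Longrightarrow> y \<in> topspace (nsphere n) \<Longrightarrow>
        \<bar>g x - g y\<bar> \<le> L * (\<Sum>j\<le>n. \<bar>x j - y j\<bar>)"
proof -
  let ?S = "topspace (nsphere n)"
  let ?D = "\<lambda>x y :: nat \<Rightarrow> real. \<Sum>j\<le>n. \<bar>x j - y j\<bar>"
  have cm: "continuous_map (nsphere n) euclideanreal k \<longleftrightarrow> continuous_on ?S k" for k
    by (subst nsphere_eq_top_of_set) simp
  define P where "P = (\<lambda>g. continuous_on ?S g \<and> (\<exists>L\<ge>0. \<forall>x\<in>?S. \<forall>y\<in>?S. \<bar>g x - g y\<bar> \<le> L * ?D x y))"
  have D0: "0 \<le> ?D x y" for x y by (simp add: sum_nonneg)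
  have "\<exists>g. P g \<and> (\<forall>x\<in>?S. \<bar>h x - g x\<bar> < e)"
  proof (rule Stone_Weierstrass_HOL[OF compact_topspace_nsphere[of n]])
    show "P (\<lambda>x. c)" for c
      unfolding P_def by (auto intro!: exI[of _ 0])
    show "continuous_on ?S g" if "P g" for g using that by (simp add: P_def)
    show "P (\<lambda>x. f x + g x)" if fg: "P f \<and> P g" for f g
    proof -
      obtain L L' where L: "0 \<le> L" "0 \<le> L'" "\<And>x y. x \<in> ?S \<Longrightarrow> y \<in> ?S \<Longrightarrow> \<bar>f x - f y\<bar> \<le> L * ?D x y"
        "\<And>x y. x \<in> ?S \<Longrightarrow> y \<in> ?S \<Longrightarrow> \<bar>g x - g y\<bar> \<le> L' * ?D x y"
        using fg unfolding P_def by blast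
      have "\<bar>(f x + g x) - (f y + g y)\<bar> \<le> (L + L') * ?D x y" if "x \<in> ?S" "y \<in> ?S" for x y
        using L(3)[OF that] L(4)[OF that] by (simp add: distrib_right)
      then show ?thesis
        using fg L unfolding P_def by (auto intro: continuous_on_add exI[of _ "L + L'"])
    qed
    show "P (\<lambda>x. f x * g x)" if fg: "P f \<and> P g" for f g
    proof -
      obtain L L' where L: "0 \<le> L" "0 \<le> L'" "\<And>x y. x \<in> ?S \<Longrightarrow> y \<in> ?S \<Longrightarrow> \<bar>f x - f y\<bar> \<le> L * ?D x y"
        "\<And>x y. x \<in> ?S \<Longrightarrow> y \<in> ?S \<Longrightarrow> \<bar>g x - g y\<bar> \<le> L' * ?D x y"
        using fg unfolding P_def by blast
      \<comment> \<open>Products of Lipschitz functions are Lipschitz only given bounds on the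
        factors, which compactness supplies.\<close>
      have "bounded (f ` ?S)" "bounded (g ` ?S)"
        using fg unfolding P_def
        by (auto intro!: compact_imp_bounded compact_continuous_image compact_topspace_nsphere)
      then obtain M M' where M: "0 < M" "0 < M'" "\<And>x. x \<in> ?S \<Longrightarrow> \<bar>f x\<bar> \<le> M" "\<And>x. x \<in> ?S \<Longrightarrow> \<bar>g x\<bar> \<le> M'"
        by (auto simp: bounded_pos)
      have "\<bar>f x * g x - f y * g y\<bar> \<le> (M * L' + M' * L) * ?D x y" if "x \<in> ?S" "y \<in> ?S" for x y
      proof -
        have "\<bar>f x * g x - f y * g y\<bar> = \<bar>f x * (g x - g y) + g y * (f x - f y)\<bar>"
          by (simp add: algebra_simps)
        also have "\<dots> \<le> \<bar>f x\<bar> * \<bar>g x - g y\<bar> + \<bar>g y\<bar> * \<bar>f x - f y\<bar>"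
          using abs_triangle_ineq[of "f x * (g x - g y)" "g y * (f x - f y)"] by (simp add: abs_mult)
        also have "\<dots> \<le> M * (L' * ?D x y) + M' * (L * ?D x y)"
          using L M that by (intro add_mono mult_mono) auto
        finally show ?thesis by (simp add: algebra_simps)
      qed
      then show ?thesis
        using fg L M unfolding P_def
        by (auto intro: continuous_on_mult exI[of _ "M * L' + M' * L"])
    qed
    show "\<exists>f. P f \<and> f x \<noteq> f y" if xy: "x \<in> ?S \<and> y \<in> ?S \<and> x \<noteq> y" for x y
    proof -
      obtain i where i: "x i \<noteq> y i" using xy by auto
      have "\<bar>u i - v i\<bar> \<le> ?D u v" if "u \<in> ?S" "v \<in> ?S" for u v
      proof (cases "i \<le> n")
        case True
        then show ?thesis by (intro member_le_sum[of i _ "\<lambda>j. \<bar>u j - v j\<bar>"]) auto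
      next
        case False
        then show ?thesis using that D0[of u v] by (simp add: topspace_nsphere_iff)
      qed
      then have "P (\<lambda>x. x i)"
        unfolding P_def
        by (auto intro!: exI[of _ 1] continuous_on_subset[OF continuous_on_product_coordinates])
      then show ?thesis using i by blast
    qed
  qed (use assms cm in auto)
  then obtain g where "P g" "\<forall>x\<in>?S. \<bar>h x - g x\<bar> < e" by blast
  then show ?thesis using that[of g] unfolding P_def cm by blast
qed

text \<open>Approximate each coordinate separately and take odd parts. As \<open>f\<close> is odd,
  the new error at \<open>x\<close> is half the difference of the old errors at \<open>x\<close> and
  \<open>- x\<close>, so it stays below \<open>e\<close>.\<close>

lemma odd_Lipschitz_approximation_nsphere:
  assumes f: "continuous_map (nsphere n) (nsphere n) f" and "0 < e"
    and odd: "\<And>x. x \<in> topspace (nsphere n) \<Longrightarrow> f (\<lambda>i. - x i) = (\<lambda>i. - f x i)"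
  obtains g L where "\<And>i. continuous_map (nsphere n) euclideanreal (\<lambda>x. g x i)"
    "\<And>x i. x \<in> topspace (nsphere n) \<Longrightarrow> g (\<lambda>i. - x i) i = - g x i"
    "\<And>x i. x \<in> topspace (nsphere n) \<Longrightarrow> \<bar>f x i - g x i\<bar> < e" "0 \<le> L"
    "\<And>x y i. x \<in> topspace (nsphere n) \<Longrightarrow> y \<in> topspace (nsphere n) \<Longrightarrow> i \<le> n \<Longrightarrow>
        \<bar>g x i - g y i\<bar> \<le> L * (\<Sum>j\<le>n. \<bar>x j - y j\<bar>)"
proof -
  let ?S = "topspace (nsphere n)"
  let ?D = "\<lambda>x y :: nat \<Rightarrow> real. \<Sum>j\<le>n. \<bar>x j - y j\<bar>"
  let ?u = "\<lambda>x :: nat \<Rightarrow> real. \<lambda>i. - x i"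
  define Q where "Q = (\<lambda>i h L. continuous_map (nsphere n) euclideanreal h \<and>
      (\<forall>x\<in>?S. \<bar>f x i - h x\<bar> < e) \<and> 0 \<le> L \<and> (\<forall>x\<in>?S. \<forall>y\<in>?S. \<bar>h x - h y\<bar> \<le> L * ?D x y))"
  have "\<exists>h L. Q i h L" for i
  proof -
    have "continuous_map (nsphere n) euclideanreal (\<lambda>x. f x i)"
      using f by (simp add: continuous_map_into_nsphere)
    then show ?thesis
    proof (rule Lipschitz_approximation_nsphere[OF _ \<open>0 < e\<close>])
      fix h L
      assume "continuous_map (nsphere n) euclideanreal h"
        "\<And>x. x \<in> ?S \<Longrightarrow> \<bar>f x i - h x\<bar> < e" "0 \<le> L"
        "\<And>x y. x \<in> ?S \<Longrightarrow> y \<in> ?S \<Longrightarrow> \<bar>h x - h y\<bar> \<le> L * ?D x y"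
      then have "Q i h L" unfolding Q_def by simp
      then show ?thesis by blast
    qed
  qed
  then obtain g L where "\<And>i. Q i (g i) (L i)" by metis
  then have g: "\<And>i. continuous_map (nsphere n) euclideanreal (g i)"
    "\<And>i x. x \<in> ?S \<Longrightarrow> \<bar>f x i - g i x\<bar> < e" "\<And>i. 0 \<le> L i"
    "\<And>i x y. x \<in> ?S \<Longrightarrow> y \<in> ?S \<Longrightarrow> \<bar>g i x - g i y\<bar> \<le> L i * ?D x y"
    unfolding Q_def by simp_all
  define G where "G = (\<lambda>x i. (g i x - g i (?u x)) / 2)"
  \<comment> \<open>One Lipschitz constant for all coordinates up to \<open>n\<close>; this is why
    the conclusion bounds \<open>i\<close>.\<close>
  define C where "C = (\<Sum>i\<le>n. L i)"
  have D0: "0 \<le> ?D x y" for x y by (simp add: sum_nonneg)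
  show ?thesis
  proof (rule that[of G C])
    show "continuous_map (nsphere n) euclideanreal (\<lambda>x. G x i)" for i
      unfolding G_def using continuous_map_compose[OF continuous_map_nsphere_antipodal g(1)[of i]]
      by (intro continuous_map_real_divide continuous_map_diff g continuous_map_const[THEN iffD2]) (simp_all add: o_def)
    show "G (?u x) i = - G x i" if "x \<in> ?S" for x i
      by (simp add: G_def field_simps)
    show "\<bar>f x i - G x i\<bar> < e" if "x \<in> ?S" for x i
    proof -
      have "f x i - G x i = ((f x i - g i x) - (f (?u x) i - g i (?u x))) / 2"
        using odd[OF that] by (simp add: G_def field_simps)
      then show ?thesis
        using g(2)[OF that, of i] g(2)[OF topspace_nsphere_uminus[OF that], of i]
        by (simp add: abs_less_iff)
    qed
    show "0 \<le> C" unfolding C_def by (simp add: sum_nonneg g(3))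
    show "\<bar>G x i - G y i\<bar> \<le> C * ?D x y" if xy: "x \<in> ?S" "y \<in> ?S" and "i \<le> n" for x y i
    proof -
      have "?D (?u x) (?u y) = ?D x y"
        by (intro sum.cong refl) (simp add: abs_minus_commute)
      then have "\<bar>g i (?u x) - g i (?u y)\<bar> \<le> L i * ?D x y"
        using g(4)[OF topspace_nsphere_uminus[OF xy(1)] topspace_nsphere_uminus[OF xy(2)], of i] by (simp only:)
      moreover have "L i \<le> C"
        unfolding C_def using \<open>i \<le> n\<close> g(3) by (intro member_le_sum) auto
      then have "L i * ?D x y \<le> C * ?D x y" using D0 by (rule mult_right_mono)
      moreover have "G x i - G y i = ((g i x - g i y) - (g i (?u x) - g i (?u y))) / 2"
        by (simp add: G_def field_simps)
      ultimately show ?thesis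
        using g(4)[OF xy, of i] by (simp add: abs_le_iff)
    qed
  qed
qed

text \<open>
  Pigeonhole: in a grid of \<open>M\<^sup>k\<^sup>+\<^sup>2\<close> points, two would have preimages in a common cube of side
  \<open>1 / N\<close>, since \<open>N\<close> proportional to \<open>M\<close> gives only \<open>O(M\<^sup>k\<^sup>+\<^sup>1)\<close> cubes.
\<close>

lemma Lipschitz_misses_point:
  fixes G :: "(nat \<Rightarrow> real) \<Rightarrow> nat \<Rightarrow> real" and B L :: real
  assumes lip: "\<And>y z i. i \<le> Suc k \<Longrightarrow> \<bar>G y i - G z i\<bar> \<le> L * (\<Sum>j\<le>k. \<bar>y j - z j\<bar>)"
  obtains p where "\<And>i. i \<le> Suc k \<Longrightarrow> 1 \<le> p i \<and> p i \<le> 2"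
    "\<And>y. (\<forall>j\<le>k. \<bar>y j\<bar> \<le> B) \<Longrightarrow> \<exists>i\<le>Suc k. G y i \<noteq> p i"
proof (rule ccontr)
  assume "\<not> thesis"
  with that have ex: "\<exists>y. (\<forall>j\<le>k. \<bar>y j\<bar> \<le> B) \<and> (\<forall>i\<le>Suc k. G y i = p i)"
    if "\<And>i. i \<le> Suc k \<Longrightarrow> 1 \<le> p i \<and> p i \<le> 2" for p
    using that by metis
  \<comment> \<open>\<open>Q\<close> makes images of two points in a common cube of side
    \<open>1 / N\<close> differ by less than \<open>Q / N = 1 / M\<close> per coordinate. Each axis
    meets at most \<open>2 * N * B' + 1 \<le> M * C\<close> cubes, and \<open>M > C ^ Suc k\<close>
    makes the grid outnumber all cubes.\<close>
  obtain Q :: nat where Q: "\<bar>L\<bar> * (real k + 1) < Q" using reals_Archimedean2 by blast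
  obtain B' :: nat where B': "B < B'" using reals_Archimedean2 by blast
  define C where "C = 2 * Q * B' + 1"
  define M where "M = C ^ Suc k + 1"
  define N where "N = M * Q"
  have pos: "0 < M" "0 < Q" "0 < N" "0 < C"
  proof -
    show "0 < M" "0 < C" by (simp_all add: M_def C_def)
    have "0 \<le> \<bar>L\<bar> * (real k + 1)" by simp
    then show "0 < Q" using Q by (metis of_nat_0_less_iff order_le_less_trans)
    then show "0 < N" using \<open>0 < M\<close> by (simp add: N_def)
  qed
  define A where "A = {..Suc k} \<rightarrow>\<^sub>E {..<M}"
  have "\<exists>y. (\<forall>j\<le>k. \<bar>y j\<bar> \<le> B) \<and> (\<forall>i\<le>Suc k. G y i = 1 + real (a i) / real M)" if "a \<in> A" for a
  proof (rule ex)
    fix i assume "i \<le> Suc k"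
    then have "a i < M" using that by (auto simp: A_def)
    then show "1 \<le> 1 + real (a i) / real M \<and> 1 + real (a i) / real M \<le> 2" using pos by simp
  qed
  then obtain y where y: "\<And>a j. a \<in> A \<Longrightarrow> j \<le> k \<Longrightarrow> \<bar>y a j\<bar> \<le> B"
    "\<And>a i. a \<in> A \<Longrightarrow> i \<le> Suc k \<Longrightarrow> G (y a) i = 1 + real (a i) / real M"
    by metis
  \<comment> \<open>The integer label of the cube containing the chosen preimage \<open>y a\<close>
    of the grid point \<open>a\<close>.\<close>
  define T where "T = (\<lambda>a. \<lambda>j\<in>{..k}. \<lfloor>real N * y a j\<rfloor>)"
  have "T ` A \<subseteq> {..k} \<rightarrow>\<^sub>E {- int (N * B')..int (N * B')}"
  proof clarify
    fix a assume a: "a \<in> A"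
    have "- int (N * B') \<le> \<lfloor>real N * y a j\<rfloor> \<and> \<lfloor>real N * y a j\<rfloor> \<le> int (N * B')" if "j \<le> k" for j
    proof -
      have "\<bar>y a j\<bar> \<le> B'" using y(1)[OF a that] B' by simp
      then have "\<bar>real N * y a j\<bar> \<le> real N * real B'" by (simp add: abs_mult mult_left_mono)
      then show ?thesis by (simp add: le_floor_iff floor_le_iff abs_le_iff)
    qed
    then show "T a \<in> {..k} \<rightarrow>\<^sub>E {- int (N * B')..int (N * B')}" by (auto simp: T_def)
  qed
  moreover have "inj_on T A"
  proof (rule inj_onI)
    fix a b assume ab: "a \<in> A" "b \<in> A" and eq: "T a = T b"
    have close: "\<bar>y a j - y b j\<bar> \<le> 1 / N" if "j \<le> k" for j
    proof -
      have "\<lfloor>real N * y a j\<rfloor> = \<lfloor>real N * y b j\<rfloor>"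
        using fun_cong[OF eq, of j] that by (simp add: T_def)
      then have "\<bar>real N * y a j - real N * y b j\<bar> < 1"
        by linarith
      then have "real N * \<bar>y a j - y b j\<bar> < 1"
        by (metis abs_mult abs_of_nat right_diff_distrib)
      then show ?thesis using pos by (simp add: field_simps)
    qed
    have "a i = b i" if i: "i \<le> Suc k" for i
    proof -
      have "\<bar>real (a i) - real (b i)\<bar> / M = \<bar>G (y a) i - G (y b) i\<bar>"
        using y(2)[OF ab(1) i] y(2)[OF ab(2) i] pos by (simp add: diff_divide_distrib[symmetric])
      also have "\<dots> \<le> \<bar>L\<bar> * (\<Sum>j\<le>k. \<bar>y a j - y b j\<bar>)"
        by (rule order_trans[OF lip[OF i]]) (auto intro!: mult_right_mono sum_nonneg)
      also have "\<dots> \<le> \<bar>L\<bar> * (\<Sum>j\<le>k. 1 / N)"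
        using close by (intro mult_left_mono sum_mono) auto
      also have "\<dots> = \<bar>L\<bar> * (real k + 1) / N" by simp
      also have "\<dots> < Q / N" using Q pos by (simp add: divide_strict_right_mono)
      also have "\<dots> = 1 / M" using pos by (simp add: N_def)
      finally have "\<bar>real (a i) - real (b i)\<bar> < 1" using pos by (simp add: divide_less_cancel)
      then show ?thesis by linarith
    qed
    then show "a = b" using ab unfolding A_def by (intro PiE_ext) auto
  qed
  ultimately have "card A \<le> card ({..k} \<rightarrow>\<^sub>E {- int (N * B')..int (N * B')})"
    by (intro card_inj_on_le[of T]) (auto intro!: finite_PiE)
  moreover have "nat (1 + 2 * (int B' * int N)) = 2 * N * B' + 1"
    by (simp add: nat_eq_iff)
  ultimately have "M ^ Suc (Suc k) \<le> (2 * N * B' + 1) ^ Suc k"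
    unfolding A_def by (simp add: card_PiE algebra_simps del: power_Suc)
  also have "2 * N * B' + 1 \<le> M * C" using pos by (simp add: N_def C_def algebra_simps)
  then have "(2 * N * B' + 1) ^ Suc k \<le> (M * C) ^ Suc k" by (rule power_mono) simp
  also have "\<dots> = M ^ Suc k * C ^ Suc k" by (rule power_mult_distrib)
  also have "\<dots> < M ^ Suc k * M" using pos by (simp add: M_def)
  finally show False by simp
qed

lemma L2_set_diff_le_sum_abs: "\<bar>L2_set y A - L2_set z A\<bar> \<le> (\<Sum>j\<in>A. \<bar>y j - z j\<bar>)"
proof -
  have "L2_set y A \<le> L2_set z A + (\<Sum>j\<in>A. \<bar>y j - z j\<bar>)" for y z
    using L2_set_triangle_ineq[of z "\<lambda>j. y j - z j" A] L2_set_le_sum_abs[of "\<lambda>j. y j - z j" A] by simp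
  from this[of y z] this[of z y] show ?thesis
    by (simp add: abs_le_iff abs_minus_commute algebra_simps)
qed

text \<open>The factor \<open>L2_set\<close> cancels the blow-up of radial projection at the origin.
  This extends a map from the sphere to all of space as a cone, to which
  \<open>Lipschitz_misses_point\<close> applies.\<close>

lemma Lipschitz_homogeneous_extension:
  fixes g :: "(nat \<Rightarrow> real) \<Rightarrow> real"
  assumes M: "\<And>x. x \<in> topspace (nsphere k) \<Longrightarrow> \<bar>g x\<bar> \<le> M"
    and L: "\<And>x y. x \<in> topspace (nsphere k) \<Longrightarrow> y \<in> topspace (nsphere k) \<Longrightarrow>
        \<bar>g x - g y\<bar> \<le> L * (\<Sum>j\<le>k. \<bar>x j - y j\<bar>)" "0 \<le> L"
  shows "\<bar>L2_set y {..k} * g (normalized k y) - L2_set z {..k} * g (normalized k z)\<bar>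
      \<le> (M + L * (real k + 2)) * (\<Sum>j\<le>k. \<bar>y j - z j\<bar>)"
proof -
  let ?n = "\<lambda>y. L2_set y {..k}"
  let ?u = "normalized k"
  let ?D = "\<Sum>j\<le>k. \<bar>y j - z j\<bar>"
  have D0: "0 \<le> ?D" by (simp add: sum_nonneg)
  have nD: "\<bar>?n y - ?n z\<bar> \<le> ?D" by (rule L2_set_diff_le_sum_abs)
  have inS: "?u w \<in> topspace (nsphere k)" if "?n w \<noteq> 0" for w
    using that by (intro normalized_in_nsphere) (metis L2_set_0' atMost_iff)
  have M0: "0 \<le> M" using M[OF in_topspace_nsphere] by (meson abs_ge_zero order_trans)
  have D: "M * ?D \<le> (M + L * (real k + 2)) * ?D"
    using D0 L(2) by (intro mult_right_mono) auto
  \<comment> \<open>At norm 0 the normalized vector is off the sphere and nothing is known of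
    \<open>g\<close> there, but the factor in front is 0.\<close>
  consider "?n y = 0" "?n z = 0" | "?n y \<noteq> 0" "?n z = 0" | "?n y = 0" "?n z \<noteq> 0" | "?n y \<noteq> 0" "?n z \<noteq> 0"
    by blast
  then show ?thesis
  proof cases
    case 1
    then show ?thesis using D0 M0 L(2) by simp
  next
    case 2
    have "\<bar>?n y * g (?u y)\<bar> \<le> ?D * M"
      unfolding abs_mult using nD 2 M[OF inS[OF 2(1)]] D0 by (intro mult_mono) auto
    then show ?thesis using 2 D by (simp add: mult.commute)
  next
    case 3
    have "\<bar>?n z * g (?u z)\<bar> \<le> ?D * M"
      unfolding abs_mult using nD 3 M[OF inS[OF 3(2)]] D0 by (intro mult_mono) auto
    then show ?thesis using 3 D by (simp add: mult.commute)
  next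
    case 4
    have "?n z * \<bar>?u y j - ?u z j\<bar> \<le> \<bar>y j - z j\<bar> + ?D" if "j \<le> k" for j
    proof -
      have "?n z * (?u y j - ?u z j) = (y j - z j) - (?n y - ?n z) * ?u y j"
        using 4 that by (simp add: normalized_def field_simps)
      then have "?n z * \<bar>?u y j - ?u z j\<bar> = \<bar>(y j - z j) - (?n y - ?n z) * ?u y j\<bar>"
        by (metis L2_set_nonneg abs_mult abs_of_nonneg)
      also have "\<dots> \<le> \<bar>y j - z j\<bar> + \<bar>?n y - ?n z\<bar> * \<bar>?u y j\<bar>"
        using abs_triangle_ineq4[of "y j - z j" "(?n y - ?n z) * ?u y j"] by (simp add: abs_mult)
      also have "\<bar>?n y - ?n z\<bar> * \<bar>?u y j\<bar> \<le> ?D * 1"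
        using nD topspace_nsphere_abs_le_1[OF inS[OF 4(1)]] D0 by (intro mult_mono) auto
      finally show ?thesis by simp
    qed
    then have "(\<Sum>j\<le>k. ?n z * \<bar>?u y j - ?u z j\<bar>) \<le> (\<Sum>j\<le>k. \<bar>y j - z j\<bar> + ?D)"
      by (intro sum_mono) auto
    \<comment> \<open>The differences contribute one \<open>?D\<close>, and the \<open>k + 1\<close>
      constant terms contribute the rest.\<close>
    then have *: "?n z * (\<Sum>j\<le>k. \<bar>?u y j - ?u z j\<bar>) \<le> (real k + 2) * ?D"
      by (simp add: sum_distrib_left sum.distrib algebra_simps)
    have "\<bar>?n y * g (?u y) - ?n z * g (?u z)\<bar> = \<bar>(?n y - ?n z) * g (?u y) + ?n z * (g (?u y) - g (?u z))\<bar>"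
      by (simp add: algebra_simps)
    also have "\<dots> \<le> \<bar>?n y - ?n z\<bar> * \<bar>g (?u y)\<bar> + ?n z * \<bar>g (?u y) - g (?u z)\<bar>"
      using abs_triangle_ineq[of "(?n y - ?n z) * g (?u y)" "?n z * (g (?u y) - g (?u z))"] by (simp add: abs_mult)
    also have "\<dots> \<le> ?D * M + ?n z * (L * (\<Sum>j\<le>k. \<bar>?u y j - ?u z j\<bar>))"
      using nD M[OF inS[OF 4(1)]] D0 L(1)[OF inS[OF 4(1)] inS[OF 4(2)]]
      by (intro add_mono mult_mono) auto
    also have "\<dots> \<le> ?D * M + L * ((real k + 2) * ?D)"
      using mult_left_mono[OF * L(2)] by (simp add: algebra_simps)
    finally show ?thesis by (simp add: algebra_simps)
  qed
qed

section \<open>Borsuk's theorem on odd maps\<close>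

text \<open>\<open>Borsuk_odd_mapping_degree_step\<close> equates the degrees modulo 2 of an odd map
  on a sphere and on its equator, provided the equator is preserved. The work lies in deforming
  \<open>f\<close> to such a map \<open>q\<close>.\<close>

theorem odd_Brouwer_degree2_odd_map:
  assumes "continuous_map (nsphere n) (nsphere n) f"
    and "\<And>x. x \<in> topspace (nsphere n) \<Longrightarrow> f (\<lambda>i. - x i) = (\<lambda>i. - f x i)"
  shows "odd (Brouwer_degree2 n f)"
  using assms
proof (induction n arbitrary: f)
  case 0
  define e where "e = (\<lambda>i::nat. if i = 0 then 1 else 0 :: real)"
  have two: "x = e \<or> x = (\<lambda>i. - e i)" if "x \<in> topspace (nsphere 0)" for x
    using that by (auto simp: topspace_nsphere_iff e_def fun_eq_iff power2_eq_1_iff)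
  have e: "e \<in> topspace (nsphere 0)"
    unfolding e_def by (rule in_topspace_nsphere)
  then have fe: "f e \<in> topspace (nsphere 0)"
    using 0 by (simp add: continuous_map_into_nsphere)
  from two[OF fe] show ?case
  proof
    assume *: "f e = e"
    have "Brouwer_degree2 0 f = Brouwer_degree2 0 id"
      using two * 0(2)[OF e] by (intro Brouwer_degree2_eq) auto
    then show ?thesis by simp
  next
    assume *: "f e = (\<lambda>i. - e i)"
    have "Brouwer_degree2 0 f = Brouwer_degree2 0 (\<lambda>x i. - x i)"
    proof (rule Brouwer_degree2_eq)
      fix x assume "x \<in> topspace (nsphere 0)"
      then show "f x = (\<lambda>i. - x i)" using two[of x] * 0(2)[OF e] by auto
    qed
    then show ?thesis by (simp add: Brouwer_degree2_antipodal)
  qed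
next
  case (Suc k)
  let ?n = "Suc k"
  let ?S = "topspace (nsphere ?n)"
  let ?S' = "topspace (nsphere k)"
  \<comment> \<open>The \<open>?n + 1\<close> squared coordinates of \<open>f x\<close> sum to 1, so
    some coordinate is at least \<open>2 * e\<close> in absolute value; an approximation within
    \<open>e\<close> then stays away from 0.\<close>
  define e where "e = 1 / (2 * (real ?n + 1))"
  have e: "0 < e" "2 * e * (real ?n + 1) = 1" by (simp_all add: e_def)
  have fS: "f x \<in> ?S" if "x \<in> ?S" for x
    using Suc.prems(1) that by (simp add: continuous_map_into_nsphere)
  obtain g L where g: "\<And>i. continuous_map (nsphere ?n) euclideanreal (\<lambda>x. g x i)"
    "\<And>x i. x \<in> ?S \<Longrightarrow> g (\<lambda>i. - x i) i = - g x i"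
    "\<And>x i. x \<in> ?S \<Longrightarrow> \<bar>f x i - g x i\<bar> < e"
    and L: "0 \<le> L"
    "\<And>x y i. x \<in> ?S \<Longrightarrow> y \<in> ?S \<Longrightarrow> i \<le> ?n \<Longrightarrow>
        \<bar>g x i - g y i\<bar> \<le> L * (\<Sum>j\<le>?n. \<bar>x j - y j\<bar>)"
    by (rule odd_Lipschitz_approximation_nsphere[OF Suc.prems(1) e(1) Suc.prems(2)], assumption, rule that)
  have large: "\<exists>i\<le>?n. 2 * e \<le> \<bar>f x i\<bar>" if "x \<in> ?S" for x
  proof (rule ccontr)
    assume "\<not> ?thesis"
    then have *: "\<bar>f x i\<bar> < 2 * e" if "i \<le> ?n" for i using that by (meson not_le)
    have "(f x i)\<^sup>2 < 2 * e" if "i \<le> ?n" for i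
    proof -
      have "\<bar>f x i\<bar> * \<bar>f x i\<bar> \<le> 1 * \<bar>f x i\<bar>"
        using topspace_nsphere_abs_le_1[OF fS[OF \<open>x \<in> ?S\<close>]] by (rule mult_right_mono) simp
      then show ?thesis using *[OF that] by (simp add: power2_eq_square)
    qed
    then have "(\<Sum>i\<le>?n. (f x i)\<^sup>2) < (\<Sum>i\<le>?n. 2 * e)"
      by (intro sum_strict_mono) auto
    also have "\<dots> = 1" using e(2) by (simp add: algebra_simps)
    finally show False using fS[OF that] by (simp add: topspace_nsphere_iff)
  qed
  have g_large: "\<exists>i\<le>?n. e \<le> \<bar>g x i\<bar>" if x: "x \<in> ?S" for x
  proof -
    obtain i where i: "i \<le> ?n" "2 * e \<le> \<bar>f x i\<bar>" using large[OF x] by blast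
    have "e \<le> \<bar>g x i\<bar>" using g(3)[OF x, of i] i(2) by linarith
    then show ?thesis using i(1) by blast
  qed
  have S'S: "x \<in> ?S" "x ?n = 0" if "x \<in> ?S'" for x
    using that topspace_nsphere_Suc by blast+
  \<comment> \<open>A direction missed by the cone over the image of the equator. The radius
    \<open>2 / e\<close> suffices: if \<open>g x = r * p\<close> with entries of \<open>p\<close> in
    \<open>[1, 2]\<close>, then \<open>\<bar>r\<bar> \<ge> e / 2\<close>, so \<open>x / r\<close>
    has norm at most \<open>2 / e\<close>.\<close>
  obtain p where p: "\<And>i. i \<le> ?n \<Longrightarrow> 1 \<le> p i \<and> p i \<le> 2"
    "\<And>y. (\<forall>j\<le>k. \<bar>y j\<bar> \<le> 2 / e) \<Longrightarrow> \<exists>i\<le>?n. L2_set y {..k} * g (normalized k y) i \<noteq> p i"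
  proof (rule Lipschitz_misses_point[where k = k and B = "2 / e"
        and G = "\<lambda>y i. L2_set y {..k} * g (normalized k y) i" and L = "2 + L * (real k + 2)"])
    fix y z :: "nat \<Rightarrow> real" and i assume i: "i \<le> ?n"
    show "\<bar>L2_set y {..k} * g (normalized k y) i - L2_set z {..k} * g (normalized k z) i\<bar>
       \<le> (2 + L * (real k + 2)) * (\<Sum>j\<le>k. \<bar>y j - z j\<bar>)"
    proof (rule Lipschitz_homogeneous_extension[where g = "\<lambda>x. g x i"])
      fix x assume x: "x \<in> ?S'"
      have "e \<le> 1" by (simp add: e_def)
      then show "\<bar>g x i\<bar> \<le> 2"
        using g(3)[OF S'S(1)[OF x], of i] topspace_nsphere_abs_le_1[OF fS[OF S'S(1)[OF x]], of i]
        by linarith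
      fix y assume y: "y \<in> ?S'"
      show "\<bar>g x i - g y i\<bar> \<le> L * (\<Sum>j\<le>k. \<bar>x j - y j\<bar>)"
        using L(2)[OF S'S(1)[OF x] S'S(1)[OF y] i] S'S(2)[OF x] S'S(2)[OF y] by simp
    qed (rule L(1))
  qed blast
  \<comment> \<open>The whole line through \<open>p\<close> is missed: \<open>r = 0\<close> is
    excluded because \<open>g\<close> is nonzero, and negative \<open>r\<close> is handled by
    oddness of \<open>g\<close>.\<close>
  have miss: "\<exists>i\<le>?n. g x i \<noteq> r * p i" if x: "x \<in> ?S'" for x r
  proof (rule ccontr)
    assume "\<not> ?thesis"
    then have eq: "g x i = r * p i" if "i \<le> ?n" for i using that by blast
    obtain i where i: "i \<le> ?n" "e \<le> \<bar>g x i\<bar>" using g_large[OF S'S(1)[OF x]] by blast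
    have "\<bar>r\<bar> * p i = \<bar>g x i\<bar>" using eq[OF i(1)] p(1)[OF i(1)] by (simp add: abs_mult)
    moreover have "\<bar>r\<bar> * p i \<le> \<bar>r\<bar> * 2" using p(1)[OF i(1)] by (intro mult_left_mono) auto
    ultimately have r: "e \<le> 2 * \<bar>r\<bar>" using i(2) by simp
    then have r0: "r \<noteq> 0" using e(1) by auto
    define y where "y = (\<lambda>j. x j / r)"
    have ny: "L2_set y {..k} = 1 / \<bar>r\<bar>"
      using L2_set_nsphere[OF x]
      by (simp add: y_def L2_set_def power_divide real_sqrt_divide flip: sum_divide_distrib)
    have "\<bar>y j\<bar> \<le> 2 / e" if "j \<le> k" for j
    proof -
      have "\<bar>y j\<bar> \<le> 1 / \<bar>r\<bar>"
        using topspace_nsphere_abs_le_1[OF x, of j] by (simp add: y_def divide_right_mono)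
      also have "\<dots> \<le> 2 / e" using r r0 e(1) by (simp add: field_simps)
      finally show ?thesis .
    qed
    then obtain i where i: "i \<le> ?n" "1 / \<bar>r\<bar> * g (normalized k y) i \<noteq> p i"
      using p(2)[of y] unfolding ny by blast
    have xk: "x j = 0" if "\<not> j \<le> k" for j using x that by (simp add: topspace_nsphere_iff)
    show False
    proof (cases "0 < r")
      case True
      then have "normalized k y = x"
        using xk unfolding normalized_def ny by (auto simp: y_def fun_eq_iff)
      then show False using i(2) eq[OF i(1)] True by simp
    next
      case False
      then have "normalized k y = (\<lambda>i. - x i)"
        using xk r0 unfolding normalized_def ny by (auto simp: y_def fun_eq_iff)
      then show False using i(2) eq[OF i(1)] g(2)[OF S'S(1)[OF x], of i] False r0 by simp
    qed
  qed
  txt \<open>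
    Shear the missed direction \<open>p\<close> onto the last axis, so that the image of the equator misses the
    last axis; damping the last coordinate then pushes the equator into itself.
  \<close>
  define h where "h = (\<lambda>x i. if i \<le> k then g x i - g x ?n / p ?n * p i else \<bar>x ?n\<bar> * g x ?n)"
  have pn: "p ?n \<noteq> 0" using p(1)[of ?n] by simp
  \<comment> \<open>If the last coordinate of \<open>g x\<close> is 0, the shear is trivial and the
    segment is constantly \<open>g x\<close>. Otherwise a zero forces \<open>t = 1\<close> and
    \<open>x\<close> on the equator, where \<open>miss\<close> applies.\<close>
  have nz: "\<exists>i\<le>?n. (1 - t) * g x i + t * h x i \<noteq> 0" if t: "0 \<le> t" "t \<le> 1" and x: "x \<in> ?S" for t x
  proof (rule ccontr)
    assume "\<not> ?thesis"
    then have z: "(1 - t) * g x i + t * h x i = 0" if "i \<le> ?n" for i using that by blast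
    have "((1 - t) + t * \<bar>x ?n\<bar>) * g x ?n = 0"
      using z[of ?n] by (simp add: h_def algebra_simps)
    then consider "g x ?n = 0" | "g x ?n \<noteq> 0" "(1 - t) + t * \<bar>x ?n\<bar> = 0" by auto
    then show False
    proof cases
      case 1
      then have "g x i = 0" if "i \<le> ?n" for i
        using z[of i] that by (cases "i = ?n") (auto simp: h_def algebra_simps)
      then show False using g_large[OF x] e(1) by fastforce
    next
      case 2
      moreover have "0 \<le> t * \<bar>x ?n\<bar>" using t by simp
      ultimately have "t = 1" using t by linarith
      then have "x ?n = 0" using 2 by simp
      then have "x \<in> ?S'" using x topspace_nsphere_Suc by blast
      then obtain i where i: "i \<le> ?n" "g x i \<noteq> g x ?n / p ?n * p i" using miss by blast
      then show False using z[of i] \<open>t = 1\<close> pn by (cases "i = ?n") (auto simp: h_def)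
    qed
  qed
  have h: "continuous_map (nsphere ?n) euclideanreal (\<lambda>x. h x i)" for i
  proof (cases "i \<le> k")
    case True
    have "continuous_map (nsphere ?n) euclideanreal (\<lambda>x. g x i - g x ?n / p ?n * p i)"
      by (intro continuous_map_diff continuous_map_real_mult continuous_map_real_divide g(1)
          continuous_map_const[THEN iffD2]) (simp_all add: pn)
    with True show ?thesis by (simp add: h_def)
  next
    case False
    have "continuous_map (nsphere ?n) euclideanreal (\<lambda>x. \<bar>x ?n\<bar> * g x ?n)"
      by (intro continuous_map_real_mult continuous_map_real_abs continuous_map_nsphere_projection g(1))
    with False show ?thesis by (simp add: h_def)
  qed
  have h0: "\<exists>i\<le>?n. h x i \<noteq> 0" if "x \<in> ?S" for x
    using nz[of 1 x] that by simp
  define q where "q = (\<lambda>x. normalized ?n (h x))"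
  have q: "continuous_map (nsphere ?n) (nsphere ?n) q"
    unfolding q_def by (rule continuous_map_normalized[OF h h0])
  have q_odd: "q (\<lambda>i. - x i) = (\<lambda>i. - q x i)" if "x \<in> ?S" for x
  proof -
    \<comment> \<open>The damping factor is the even function \<open>\<bar>x ?n\<bar>\<close>, so
      \<open>h\<close> inherits oddness from \<open>g\<close>.\<close>
    have "h (\<lambda>i. - x i) = (\<lambda>i. - h x i)"
      using g(2)[OF that] by (auto simp: h_def fun_eq_iff)
    then show ?thesis by (simp add: q_def normalized_uminus)
  qed
  have q_equator: "q x \<in> ?S'" if "x \<in> ?S'" for x
  proof -
    have "q x \<in> ?S" using q S'S(1)[OF that] by (simp add: continuous_map_into_nsphere)
    moreover have "q x ?n = 0" using S'S(2)[OF that] by (simp add: q_def normalized_def h_def)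
    ultimately show ?thesis using topspace_nsphere_Suc by blast
  qed
  have sub: "nsphere k = subtopology (nsphere ?n) {x. x ?n = 0}"
    by (rule subtopology_nsphere_equator[symmetric])
  have "continuous_map (nsphere k) euclideanreal (\<lambda>x. q x i)" for i
    unfolding sub using q by (intro continuous_map_from_subtopology) (simp add: continuous_map_into_nsphere)
  then have "continuous_map (nsphere k) (nsphere k) q"
    using q_equator by (simp add: continuous_map_into_nsphere)
  then have "odd (Brouwer_degree2 k q)"
    using Suc.IH q_odd S'S(1) by blast
  moreover have "even (Brouwer_degree2 ?n q - Brouwer_degree2 k q)"
    using Borsuk_odd_mapping_degree_step[OF q] q_odd q_equator by simp
  ultimately have odd: "odd (Brouwer_degree2 ?n q)" by simp
  have "Brouwer_degree2 ?n f = Brouwer_degree2 ?n (\<lambda>x. normalized ?n (f x))"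
    using fS by (intro Brouwer_degree2_eq) (simp add: normalized_nsphere)
  also have "\<dots> = Brouwer_degree2 ?n (\<lambda>x. normalized ?n (g x))"
  proof (rule Brouwer_degree2_normalized_segment)
    show "continuous_map (nsphere ?n) euclideanreal (\<lambda>x. f x i)" for i
      using Suc.prems(1) by (simp add: continuous_map_into_nsphere)
    fix t :: real and x assume t: "0 \<le> t" "t \<le> 1" and x: "x \<in> ?S"
    obtain i where i: "i \<le> ?n" "2 * e \<le> \<bar>f x i\<bar>" using large[OF x] by blast
    have "\<bar>t * (g x i - f x i)\<bar> \<le> 1 * \<bar>g x i - f x i\<bar>"
      unfolding abs_mult using t by (intro mult_right_mono) auto
    then have "\<bar>t * (g x i - f x i)\<bar> < \<bar>f x i\<bar>"
      using g(3)[OF x, of i] i(2) e(1) by (simp add: abs_minus_commute)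
    then have "f x i + t * (g x i - f x i) \<noteq> 0" by (auto simp: add_eq_0_iff)
    then show "\<exists>i\<le>?n. (1 - t) * f x i + t * g x i \<noteq> 0"
      using i(1) by (auto simp: algebra_simps intro!: exI[of _ i])
  qed (rule g(1))
  also have "\<dots> = Brouwer_degree2 ?n q"
    unfolding q_def by (rule Brouwer_degree2_normalized_segment[OF g(1) h nz])
  finally show ?case using odd by simp
qed

section \<open>Hom complexes between simplices\<close>

text \<open>
  A point of the Hom complex from a simplex on \<open>S\<close> to the simplex on \<open>N\<close> is a matrix whose rows have
  pairwise disjoint supports. The rows need not be normalized here, and a cell is encoded by the set
  of positions at which its matrices may be nonzero.
\<close>

definition hom_cells :: "'a set \<Rightarrow> nat set \<Rightarrow> ('a \<times> nat) set set" where
  "hom_cells S N = {\<eta>. \<eta> \<subseteq> S \<times> N \<and> (\<forall>v\<in>S. \<exists>j. (v, j) \<in> \<eta>) \<and>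
     (\<forall>v w j. (v, j) \<in> \<eta> \<and> (w, j) \<in> \<eta> \<longrightarrow> v = w)}"

definition hom_point :: "'a set \<Rightarrow> nat set \<Rightarrow> ('a \<times> nat \<Rightarrow> real) \<Rightarrow> bool" where
  "hom_point S N M \<longleftrightarrow> (\<forall>e\<in>S \<times> N. 0 \<le> M e) \<and> (\<forall>v\<in>S. \<exists>j\<in>N. 0 < M (v, j)) \<and>
     (\<forall>v\<in>S. \<forall>w\<in>S. \<forall>j\<in>N. v \<noteq> w \<longrightarrow> M (v, j) * M (w, j) = 0)"

text \<open>Exchanging the rows \<open>a\<close> and \<open>b\<close> flips the sign, as the two minima are distinct.\<close>

definition cell_sign :: "'a \<Rightarrow> 'a \<Rightarrow> ('a \<times> nat) set \<Rightarrow> real" where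
  "cell_sign a b \<eta> = (if (LEAST j. (a, j) \<in> \<eta>) < (LEAST j. (b, j) \<in> \<eta>) then 1 else - 1)"

text \<open>A cell with \<open>k\<close> positions has dimension \<open>k - card S\<close>, so there
  is one coordinate for each dimension. Each summand vanishes unless \<open>M\<close> is nonzero on
  the whole cell.\<close>

definition hom_coordinate ::
    "'a \<Rightarrow> 'a \<Rightarrow> 'a set \<Rightarrow> nat set \<Rightarrow> ('a \<times> nat \<Rightarrow> real) \<Rightarrow> nat \<Rightarrow> real" where
  "hom_coordinate a b S N M k =
     (\<Sum>\<eta>\<in>{\<eta> \<in> hom_cells S N. card \<eta> = k}. cell_sign a b \<eta> * prod M \<eta>)"

section \<open>The coordinates of the equivariant map to the sphere\<close>

lemma hom_point_nonneg: "hom_point S N M \<Longrightarrow> e \<in> S \<times> N \<Longrightarrow> 0 \<le> M e"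
  by (cases e) (simp add: hom_point_def)

lemma hom_point_disjoint:
  "hom_point S N M \<Longrightarrow> v \<in> S \<Longrightarrow> w \<in> S \<Longrightarrow> j \<in> N \<Longrightarrow> v \<noteq> w \<Longrightarrow> M (v, j) * M (w, j) = 0"
  by (simp add: hom_point_def)

lemma finite_hom_cells: "finite S \<Longrightarrow> finite N \<Longrightarrow> finite (hom_cells S N)"
  by (rule finite_subset[of _ "Pow (S \<times> N)"]) (auto simp: hom_cells_def)

lemma hom_cells_unique: "\<eta> \<in> hom_cells S N \<Longrightarrow> (v, j) \<in> \<eta> \<Longrightarrow> (w, j) \<in> \<eta> \<Longrightarrow> v = w"
  unfolding hom_cells_def by blast

text \<open>\<open>fst\<close> maps a cell onto \<open>S\<close>, and \<open>snd\<close> is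
  injective on it because rows are disjoint. For \<open>card S = d + 1\<close> and
  \<open>card N = m + d + 1\<close> this leaves exactly \<open>m + 1\<close> coordinates, those of
  the space containing the \<open>m\<close>-sphere.\<close>

lemma card_hom_cell:
  assumes "finite S" "finite N" "\<eta> \<in> hom_cells S N"
  shows "card S \<le> card \<eta>" "card \<eta> \<le> card N"
proof -
  have fin: "finite \<eta>" using assms by (auto simp: hom_cells_def intro: finite_subset)
  have "S = fst ` \<eta>" using assms(3) by (force simp: hom_cells_def)
  then show "card S \<le> card \<eta>" using card_image_le[OF fin] by simp
  have "inj_on snd \<eta>"
    using hom_cells_unique[OF assms(3)] by (auto simp: inj_on_def)
  moreover have "snd ` \<eta> \<subseteq> N" using assms(3) by (auto simp: hom_cells_def)
  ultimately show "card \<eta> \<le> card N" using assms(2) by (intro card_inj_on_le[of snd]) auto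
qed

text \<open>
  In the coordinate indexed by the size of the support of \<open>M\<close>, only the cell given by this support
  contributes.
\<close>

lemma hom_coordinate_nonzero:
  assumes fin: "finite S" "finite N" and M: "hom_point S N M"
  obtains k where "card S \<le> k" "k \<le> card N" "hom_coordinate a b S N M k \<noteq> 0"
proof -
  let ?A = "S \<times> N"
  define \<eta> where "\<eta> = {e \<in> ?A. 0 < M e}"
  have finA: "finite ?A" using fin by simp
  have cell: "\<eta> \<in> hom_cells S N"
    unfolding hom_cells_def
  proof (intro CollectI conjI ballI allI impI)
    show "\<eta> \<subseteq> ?A" by (auto simp: \<eta>_def)
    show "\<exists>j. (v, j) \<in> \<eta>" if "v \<in> S" for v
      using M that by (auto simp: hom_point_def \<eta>_def)
    show "v = w" if "(v, j) \<in> \<eta> \<and> (w, j) \<in> \<eta>" for v w j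
    proof (rule ccontr)
      assume "v \<noteq> w"
      have *: "v \<in> S" "w \<in> S" "j \<in> N" "M (v, j) \<noteq> 0" "M (w, j) \<noteq> 0"
        using that by (simp_all add: \<eta>_def)
      have "M (v, j) * M (w, j) = 0"
        using hom_point_disjoint[OF M *(1-3) \<open>v \<noteq> w\<close>] .
      then show False using *(4,5) by simp
    qed
  qed
  have sub: "\<theta> \<subseteq> ?A" if "\<theta> \<in> hom_cells S N" for \<theta> using that by (auto simp: hom_cells_def)
  have pos: "0 < prod M \<eta>" by (rule prod_pos) (simp add: \<eta>_def)
  \<comment> \<open>A nonzero product would put \<open>\<theta>\<close> inside the support
    \<open>\<eta>\<close>, and equal cardinality would force equality.\<close>
  have "prod M \<theta> = 0" if \<theta>: "\<theta> \<in> hom_cells S N" "card \<theta> = card \<eta>" "\<theta> \<noteq> \<eta>" for \<theta>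
  proof (rule ccontr)
    have finc: "finite \<theta>" "finite \<eta>"
      using finite_subset[OF sub finA] cell \<theta>(1) by simp_all
    assume "prod M \<theta> \<noteq> 0"
    then have nz: "M e \<noteq> 0" if "e \<in> \<theta>" for e using that finc(1) by simp
    have "e \<in> \<eta>" if "e \<in> \<theta>" for e
    proof -
      have "e \<in> ?A" using that sub[OF \<theta>(1)] by blast
      moreover from this have "0 \<le> M e" by (rule hom_point_nonneg[OF M])
      ultimately show ?thesis using nz[OF that] by (simp add: \<eta>_def)
    qed
    then have "\<theta> \<subseteq> \<eta>" by blast
    from card_subset_eq[OF finc(2) this \<theta>(2)] show False using \<theta>(3) by simp
  qed
  then have "hom_coordinate a b S N M (card \<eta>) = (\<Sum>\<theta>\<in>{\<eta>}. cell_sign a b \<theta> * prod M \<theta>)"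
    unfolding hom_coordinate_def
    by (intro sum.mono_neutral_right) (use cell finite_hom_cells[OF fin] in simp_all)
  then have "hom_coordinate a b S N M (card \<eta>) \<noteq> 0"
    using pos by (simp add: cell_sign_def)
  with card_hom_cell[OF fin cell] show ?thesis by (rule that)
qed

lemma hom_coordinate_cong:
  assumes "\<And>e. e \<in> S \<times> N \<Longrightarrow> M e = M' e"
  shows "hom_coordinate a b S N M k = hom_coordinate a b S N M' k"
proof -
  have "prod M \<eta> = prod M' \<eta>" if "\<eta> \<in> hom_cells S N" for \<eta>
    using that assms by (intro prod.cong refl) (auto simp: hom_cells_def)
  then show ?thesis unfolding hom_coordinate_def by (intro sum.cong refl) auto
qed

text \<open>Permuting rows by \<open>w\<close> permutes the cells of each size and carries their
  weights along, but exchanges the least colours of \<open>a\<close> and \<open>w a\<close>, so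
  every sign flips. This is where a vertex moved by \<open>w\<close> is essential.\<close>

lemma hom_coordinate_involution:
  assumes w: "\<And>v. v \<in> S \<Longrightarrow> w v \<in> S \<and> w (w v) = v" and a: "a \<in> S" "w a \<noteq> a"
  shows "hom_coordinate a (w a) S N (\<lambda>e. M (w (fst e), snd e)) k = - hom_coordinate a (w a) S N M k"
proof -
  let ?A = "S \<times> N" and ?C = "{\<eta> \<in> hom_cells S N. card \<eta> = k}"
  let ?M = "\<lambda>e. M (w (fst e), snd e)"
  define f where "f = map_prod w (id :: nat \<Rightarrow> nat)"
  have ff: "f (f e) = e" and fA: "f e \<in> ?A" if "e \<in> ?A" for e
    using that w by (auto simp: f_def)
  have inj: "inj_on f ?A" by (rule inj_on_inverseI[of _ f]) (rule ff)
  have sub: "\<eta> \<subseteq> ?A" if "\<eta> \<in> ?C" for \<eta> using that by (auto simp: hom_cells_def)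
  have ffi: "f ` f ` \<eta> = \<eta>" if "\<eta> \<in> ?C" for \<eta>
  proof -
    have "(\<lambda>e. f (f e)) ` \<eta> = (\<lambda>e. e) ` \<eta>"
      using sub[OF that] ff by (intro image_cong refl) blast
    then show ?thesis by (simp add: image_image)
  qed
  have mem: "(v, j) \<in> f ` \<eta> \<longleftrightarrow> (w v, j) \<in> \<eta>" if "\<eta> \<in> ?C" "v \<in> S" for \<eta> v j
  proof
    assume "(v, j) \<in> f ` \<eta>"
    then obtain u where "(u, j) \<in> \<eta>" "v = w u" by (auto simp: f_def)
    then show "(w v, j) \<in> \<eta>" using sub[OF that(1)] w[of u] by auto
  next
    assume "(w v, j) \<in> \<eta>"
    then have "f (w v, j) \<in> f ` \<eta>" by (rule imageI)
    then show "(v, j) \<in> f ` \<eta>" using w[OF that(2)] by (simp add: f_def)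
  qed
  have fC: "f ` \<eta> \<in> ?C" if \<eta>: "\<eta> \<in> ?C" for \<eta>
  proof -
    have "f ` \<eta> \<subseteq> ?A" using sub[OF \<eta>] fA by blast
    moreover have "\<exists>j. (v, j) \<in> f ` \<eta>" if "v \<in> S" for v
      using mem[OF \<eta> that] w[OF that] \<eta> by (auto simp: hom_cells_def)
    moreover have "v = u" if "(v, j) \<in> f ` \<eta>" "(u, j) \<in> f ` \<eta>" for v u j
    proof -
      have S: "v \<in> S" "u \<in> S" using that calculation(1) by auto
      then have "(w v, j) \<in> \<eta>" "(w u, j) \<in> \<eta>" using that mem[OF \<eta>] by auto
      then have "w v = w u" using \<eta> hom_cells_unique[of \<eta> S N "w v" j "w u"] by simp
      then show ?thesis using w S by metis
    qed
    moreover have "card (f ` \<eta>) = k"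
      using \<eta> inj_on_subset[OF inj sub[OF \<eta>]] by (simp add: card_image)
    ultimately show ?thesis unfolding hom_cells_def by blast
  qed
  have weight: "prod M (f ` \<eta>) = prod ?M \<eta>" if \<eta>: "\<eta> \<in> ?C" for \<eta>
    using inj_on_subset[OF inj sub[OF \<eta>]]
    by (subst prod.reindex) (auto simp: f_def intro!: prod.cong)
  have sign: "cell_sign a (w a) (f ` \<eta>) = - cell_sign a (w a) \<eta>" if \<eta>: "\<eta> \<in> ?C" for \<eta>
  proof -
    have wa: "w a \<in> S" "w (w a) = a" using w[OF a(1)] by auto
    have ex: "\<exists>j. (a, j) \<in> \<eta>" "\<exists>j. (w a, j) \<in> \<eta>"
      using \<eta> a(1) wa(1) by (auto simp: hom_cells_def)
    have "(a, LEAST j. (a, j) \<in> \<eta>) \<in> \<eta>" "(w a, LEAST j. (w a, j) \<in> \<eta>) \<in> \<eta>"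
      using LeastI_ex[OF ex(1)] LeastI_ex[OF ex(2)] .
    then have "(LEAST j. (a, j) \<in> \<eta>) \<noteq> (LEAST j. (w a, j) \<in> \<eta>)"
      using \<eta> a(2) hom_cells_unique[of \<eta> S N "w a" _ a] by auto
    moreover have "((a, j) \<in> f ` \<eta>) = ((w a, j) \<in> \<eta>)" "((w a, j) \<in> f ` \<eta>) = ((a, j) \<in> \<eta>)" for j
      using mem[OF \<eta>] a(1) wa by auto
    ultimately show ?thesis unfolding cell_sign_def by auto
  qed
  have "hom_coordinate a (w a) S N M k = (\<Sum>\<eta>\<in>?C. - (cell_sign a (w a) \<eta> * prod ?M \<eta>))"
    unfolding hom_coordinate_def
  proof (rule sum.reindex_bij_witness[of _ "\<lambda>\<eta>. f ` \<eta>" "\<lambda>\<eta>. f ` \<eta>"])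
    fix \<eta> assume \<eta>: "\<eta> \<in> ?C"
    show "- (cell_sign a (w a) (f ` \<eta>) * prod ?M (f ` \<eta>)) = cell_sign a (w a) \<eta> * prod M \<eta>"
      using sign[OF \<eta>] weight[OF fC[OF \<eta>]] ffi[OF \<eta>] by simp
  qed (use ffi fC in auto)
  then show ?thesis unfolding hom_coordinate_def by (simp add: sum_negf)
qed

lemma continuous_map_hom_coordinate:
  assumes "finite S" "finite N"
    and "\<And>e. e \<in> S \<times> N \<Longrightarrow> continuous_map X euclideanreal (\<lambda>x. M x e)"
  shows "continuous_map X euclideanreal (\<lambda>x. hom_coordinate a b S N (M x) k)"
  unfolding hom_coordinate_def
proof (intro continuous_map_sum continuous_map_real_mult continuous_map_const[THEN iffD2])
  show "finite {\<eta> \<in> hom_cells S N. card \<eta> = k}" using finite_hom_cells[OF assms(1,2)] by simp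
  fix \<eta> assume "\<eta> \<in> {\<eta> \<in> hom_cells S N. card \<eta> = k}"
  then have sub: "\<eta> \<subseteq> S \<times> N" by (auto simp: hom_cells_def)
  then have fin: "finite \<eta>" using assms(1,2) finite_subset by auto
  show "continuous_map X euclideanreal (\<lambda>x. prod (M x) \<eta>)"
    by (rule continuous_map_prod) (use sub fin assms(3) in auto)
qed auto

section \<open>Parallel transport\<close>

text \<open>The set \<open>t - u\<close> has one element, and \<open>p\<close> fixes the rest of
  \<open>t\<close>.\<close>

lemma perspectivity_moves_one:
  assumes p: "perspectivity d K t u p" and "x \<in> t" "y \<in> t" "x \<noteq> y"
  shows "p x = x \<or> p y = y"
proof (rule ccontr)
  assume "\<not> ?thesis"
  then have "x \<notin> u" "y \<notin> u" using p assms(2,3) by (auto simp: perspectivity_def)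
  then have sub: "{x, y} \<subseteq> t - u" using assms by auto
  have "finite t" "card t = d + 1" "card (t \<inter> u) = d"
    using p by (auto simp: perspectivity_def adjacent_def simplices_def)
  then have "card (t - u) = 1" "finite (t - u)" by (simp_all add: card_Diff_subset_Int)
  then show False using card_mono[OF _ sub] \<open>x \<noteq> y\<close> by simp
qed

text \<open>The product of two distinct rows expands into four terms: two vanish within
  \<open>M\<close> and \<open>M'\<close>, the mixed ones by \<open>cross\<close>, used in both
  orders of the rows.\<close>

lemma hom_point_segment:
  assumes A: "hom_point S N M" and B: "hom_point S N M'"
    and cross: "\<And>v w j. v \<in> S \<Longrightarrow> w \<in> S \<Longrightarrow> v \<noteq> w \<Longrightarrow> j \<in> N \<Longrightarrow> M (v, j) * M' (w, j) = 0"
    and t: "0 \<le> t" "t \<le> 1"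
  shows "hom_point S N (\<lambda>e. (1 - t) * M e + t * M' e)"
  unfolding hom_point_def
proof (intro conjI ballI impI)
  have nn: "0 \<le> M e" "0 \<le> M' e" if "e \<in> S \<times> N" for e
    using hom_point_nonneg[OF A that] hom_point_nonneg[OF B that] .
  show "0 \<le> (1 - t) * M e + t * M' e" if "e \<in> S \<times> N" for e
    using nn[OF that] t by simp
  show "\<exists>j\<in>N. 0 < (1 - t) * M (v, j) + t * M' (v, j)" if "v \<in> S" for v
  proof (cases "t = 1")
    case True
    then show ?thesis using B that by (simp add: hom_point_def)
  next
    case False
    have "\<exists>j\<in>N. 0 < M (v, j)" using A that by (simp add: hom_point_def)
    then obtain j where j: "j \<in> N" "0 < M (v, j)" by (rule bexE)
    have "0 < (1 - t) * M (v, j)" using j(2) False t by simp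
    moreover have "0 \<le> t * M' (v, j)" using t nn(2)[of "(v, j)"] that j(1) by simp
    ultimately have "0 < (1 - t) * M (v, j) + t * M' (v, j)" by (rule add_pos_nonneg)
    then show ?thesis using j(1) by (rule bexI)
  qed
  show "((1 - t) * M (v, j) + t * M' (v, j)) * ((1 - t) * M (w, j) + t * M' (w, j)) = 0"
    if "v \<in> S" "w \<in> S" "j \<in> N" "v \<noteq> w" for v w j
  proof -
    have "M (v, j) * M (w, j) = 0" "M' (v, j) * M' (w, j) = 0"
      using hom_point_disjoint[OF A that] hom_point_disjoint[OF B that] .
    moreover have "M (v, j) * M' (w, j) = 0" "M (w, j) * M' (v, j) = 0"
      using cross that by auto
    ultimately show ?thesis by (simp add: algebra_simps) (auto simp: mult.commute)
  qed
qed

text \<open>Induction along the chain of perspectivities. The rows used on \<open>s\<close> change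
  from those at \<open>f v\<close> to those at \<open>p (f v)\<close>, and the segment between the
  two matrices consists of hom points, on which the coordinates never all vanish.\<close>

lemma Brouwer_degree2_projectivity:
  fixes X :: "(nat \<Rightarrow> real) \<Rightarrow> 'a \<Rightarrow> nat \<Rightarrow> real"
  assumes "projectivity d K s t g"
    and N: "finite N" "card N = m + d + 1"
    and cont: "\<And>v j. v \<in> vertex_set K \<Longrightarrow> j \<in> N \<Longrightarrow>
      continuous_map (nsphere m) euclideanreal (\<lambda>x. X x v j)"
    and point: "\<And>x u. x \<in> topspace (nsphere m) \<Longrightarrow> u \<in> K \<Longrightarrow> hom_point u N (\<lambda>e. X x (fst e) (snd e))"
  shows "Brouwer_degree2 m (\<lambda>x. normalized m (\<lambda>i. hom_coordinate a b s N (\<lambda>e. X x (g (fst e)) (snd e)) (i + d + 1))) =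
         Brouwer_degree2 m (\<lambda>x. normalized m (\<lambda>i. hom_coordinate a b s N (\<lambda>e. X x (fst e) (snd e)) (i + d + 1)))"
  using assms(1)
proof (induction rule: projectivity.induct)
  case (projectivity_id s)
  have "hom_coordinate a b s N (\<lambda>e. X x ((\<lambda>v\<in>s. v) (fst e)) (snd e)) k =
      hom_coordinate a b s N (\<lambda>e. X x (fst e) (snd e)) k" for x k
    by (rule hom_coordinate_cong) auto
  then show ?case by simp
next
  case (projectivity_step s t f u p)
  let ?q = "compose s p f"
  have f: "s \<in> K" "t \<in> K" "finite s" "card s = d + 1" "bij_betw f s t"
    using projectivity_simplices[OF projectivity_step.hyps(1)] by (auto simp: simplices_def)
  have p: "u \<in> K" "bij_betw p t u"
    using projectivity_step.hyps(2) by (auto simp: perspectivity_def adjacent_def simplices_def)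
  have ft: "f v \<in> t" if "v \<in> s" for v using f(5) that by (auto simp: bij_betw_def)
  have pu: "p x \<in> u" if "x \<in> t" for x using p(2) that by (auto simp: bij_betw_def)
  have f_eq: "f v = f w \<longleftrightarrow> v = w" if "v \<in> s" "w \<in> s" for v w
    using f(5) that by (auto simp: bij_betw_def inj_on_def)
  have p_eq: "p x = p y \<longleftrightarrow> x = y" if "x \<in> t" "y \<in> t" for x y
    using p(2) that by (auto simp: bij_betw_def inj_on_def)
  have V: "x \<in> vertex_set K" if "x \<in> t \<or> x \<in> u" for x
    using that f(2) p(1) by (auto simp: vertex_set_def)
  \<comment> \<open>Pulling rows back along an injection of \<open>s\<close> into a simplex
    \<open>r\<close> keeps them disjoint.\<close>
  have pull: "hom_point s N (\<lambda>e. X x (h (fst e)) (snd e))"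
    if "hom_point r N (\<lambda>e. X x (fst e) (snd e))" "\<And>v. v \<in> s \<Longrightarrow> h v \<in> r"
      "\<And>v w. v \<in> s \<Longrightarrow> w \<in> s \<Longrightarrow> h v = h w \<Longrightarrow> v = w" for x h r
    unfolding hom_point_def
  proof (intro conjI ballI impI)
    show "0 \<le> X x (h (fst e)) (snd e)" if "e \<in> s \<times> N" for e
      using hom_point_nonneg[OF \<open>hom_point r N _\<close>, of "(h (fst e), snd e)"]
        \<open>\<And>v. v \<in> s \<Longrightarrow> h v \<in> r\<close> that by auto
    show "\<exists>j\<in>N. 0 < X x (h (fst (v, j))) (snd (v, j))" if "v \<in> s" for v
      using \<open>hom_point r N _\<close> \<open>\<And>v. v \<in> s \<Longrightarrow> h v \<in> r\<close> that by (simp add: hom_point_def)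
    show "X x (h (fst (v, j))) (snd (v, j)) * X x (h (fst (w, j))) (snd (w, j)) = 0"
      if "v \<in> s" "w \<in> s" "j \<in> N" "v \<noteq> w" for v w j
    proof -
      have "h v \<in> r" "h w \<in> r" "h v \<noteq> h w" using that \<open>\<And>v. v \<in> s \<Longrightarrow> h v \<in> r\<close>
          \<open>\<And>v w. v \<in> s \<Longrightarrow> w \<in> s \<Longrightarrow> h v = h w \<Longrightarrow> v = w\<close> by auto
      then show ?thesis using hom_point_disjoint[OF \<open>hom_point r N _\<close>, of "h v" "h w" j] that by simp
    qed
  qed
  define H where "H = (\<lambda>c x i. hom_coordinate a b s N
      (\<lambda>e. (1 - c) * X x (f (fst e)) (snd e) + c * X x (p (f (fst e))) (snd e)) (i + d + 1))"
  have "Brouwer_degree2 m (\<lambda>x. normalized m (H 0 x)) = Brouwer_degree2 m (\<lambda>x. normalized m (H 1 x))"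
  proof (rule Brouwer_degree2_normalized_homotopy)
    fix i
    show "continuous_map (prod_topology (top_of_set {0..1}) (nsphere m)) euclideanreal
        (\<lambda>z. H (fst z) (snd z) i)"
      unfolding H_def
    proof (rule continuous_map_hom_coordinate[OF f(3) N(1)])
      fix e assume e: "e \<in> s \<times> N"
      have "continuous_map (nsphere m) euclideanreal (\<lambda>x. X x (f (fst e)) (snd e))"
        "continuous_map (nsphere m) euclideanreal (\<lambda>x. X x (p (f (fst e))) (snd e))"
        using e ft pu V by (auto intro!: cont)
      then show "continuous_map (prod_topology (top_of_set {0..1}) (nsphere m)) euclideanreal
        (\<lambda>z. (1 - fst z) * X (snd z) (f (fst e)) (snd e) + fst z * X (snd z) (p (f (fst e))) (snd e))"
        by (intro continuous_map_add continuous_map_real_mult continuous_map_diff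
            continuous_map_fst_real continuous_map_snd_comp continuous_map_const[THEN iffD2]) auto
    qed
  next
    fix c :: real and x assume c: "0 \<le> c" "c \<le> 1" and x: "x \<in> topspace (nsphere m)"
    have "hom_point s N (\<lambda>e. (1 - c) * X x (f (fst e)) (snd e) + c * X x (p (f (fst e))) (snd e))"
    proof (rule hom_point_segment[OF _ _ _ c])
      have pt: "hom_point t N (\<lambda>e. X x (fst e) (snd e))" and pu': "hom_point u N (\<lambda>e. X x (fst e) (snd e))"
        using point[OF x f(2)] point[OF x p(1)] .
      show "hom_point s N (\<lambda>e. X x (f (fst e)) (snd e))"
        by (rule pull[OF pt]) (use ft f_eq in auto)
      show "hom_point s N (\<lambda>e. X x (p (f (fst e))) (snd e))"
        by (rule pull[OF pu', of "\<lambda>v. p (f v)"]) (use ft pu f_eq p_eq in auto)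
      fix v w j assume vw: "v \<in> s" "w \<in> s" "v \<noteq> w" and j: "j \<in> N"
      have ne: "f v \<noteq> f w" "p (f v) \<noteq> p (f w)" using vw f_eq p_eq ft by auto
      \<comment> \<open>One of the two vertices is fixed by \<open>p\<close>, so both rows belong to
        the same simplex, \<open>u\<close> or \<open>t\<close>, and are disjoint there.\<close>
      have "X x (f v) j * X x (p (f w)) j = 0"
        using perspectivity_moves_one[OF projectivity_step.hyps(2) ft[OF vw(1)] ft[OF vw(2)] ne(1)]
      proof
        assume "p (f v) = f v"
        moreover have "X x (p (f v)) j * X x (p (f w)) j = 0"
          using hom_point_disjoint[OF pu' pu[OF ft[OF vw(1)]] pu[OF ft[OF vw(2)]] j ne(2)] by simp
        ultimately show ?thesis by simp
      next
        assume "p (f w) = f w"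
        moreover have "X x (f v) j * X x (f w) j = 0"
          using hom_point_disjoint[OF pt ft[OF vw(1)] ft[OF vw(2)] j ne(1)] by simp
        ultimately show ?thesis by simp
      qed
      then show "X x (f (fst (v, j))) (snd (v, j)) * X x (p (f (fst (w, j)))) (snd (w, j)) = 0"
        by simp
    qed
    then obtain k where k: "d + 1 \<le> k" "k \<le> m + d + 1"
      "hom_coordinate a b s N (\<lambda>e. (1 - c) * X x (f (fst e)) (snd e) + c * X x (p (f (fst e))) (snd e)) k \<noteq> 0"
      by (rule hom_coordinate_nonzero[OF f(3) N(1), unfolded f(4) N(2)]) (rule that)
    \<comment> \<open>The smallest cells have \<open>d + 1\<close> positions, so sphere coordinate 0
      corresponds to size \<open>d + 1\<close>.\<close>
    then have "H c x (k - (d + 1)) \<noteq> 0" by (simp add: H_def)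
    moreover have "k - (d + 1) \<le> m" using k(2) by simp
    ultimately show "\<exists>i\<le>m. H c x i \<noteq> 0" by blast
  qed
  moreover have "H 0 x = (\<lambda>i. hom_coordinate a b s N (\<lambda>e. X x (f (fst e)) (snd e)) (i + d + 1))" for x
    by (simp add: H_def)
  moreover have "H 1 x = (\<lambda>i. hom_coordinate a b s N (\<lambda>e. X x (?q (fst e)) (snd e)) (i + d + 1))" for x
    unfolding H_def by (intro ext hom_coordinate_cong) (auto simp: compose_def)
  ultimately show ?case using projectivity_step.IH by simp
qed

section \<open>Colourings\<close>

text \<open>Numbering all vertices injectively gives some colouring, so the least number of colours
  is attained.\<close>

lemma colouring_exists:
  assumes "finite K" "abstract_complex K"
  obtains c where "simplicial_vertex_map K (Pow {1..chromatic_number K}) c" "nondegenerate_on K c"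
proof -
  have fin: "finite (vertex_set K)"
    using assms by (auto simp: vertex_set_def abstract_complex_def)
  let ?n = "card (vertex_set K)"
  obtain h where h: "bij_betw h {1..?n} (vertex_set K)"
    using ex_bij_betw_nat_finite_1[OF fin] by blast
  let ?c = "inv_into {1..?n} h"
  have c: "bij_betw ?c (vertex_set K) {1..?n}" using h by (rule bij_betw_inv_into)
  have "s \<subseteq> vertex_set K" if "s \<in> K" for s using that by (auto simp: vertex_set_def)
  then have "?c ` s \<subseteq> {1..?n} \<and> inj_on ?c s" if "s \<in> K" for s
    using c that unfolding bij_betw_def by (metis image_mono inj_on_subset)
  then have "\<exists>f. simplicial_vertex_map K (Pow {1..?n}) f \<and> nondegenerate_on K f"
    unfolding simplicial_vertex_map_def nondegenerate_on_def Pow_iff by (intro exI[of _ ?c]) blast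
  then have "\<exists>f. simplicial_vertex_map K (Pow {1..chromatic_number K}) f \<and> nondegenerate_on K f"
    unfolding chromatic_number_def by (rule LeastI)
  then show ?thesis using that by blast
qed

text \<open>Barycentric weights are added over each colour class. If two vertices of
  \<open>u\<close> both had weight on one colour, they would use distinct vertices \<open>i\<close>
  and \<open>k\<close> of \<open>L\<close> of that colour, while the Hom condition makes
  \<open>{i, k}\<close> a simplex, on which \<open>c\<close> is injective.\<close>

lemma hom_point_Hom_cell:
  assumes L: "finite (vertex_set L)"
    and c: "nondegenerate_on L c" "\<And>i. i \<in> vertex_set L \<Longrightarrow> c i \<in> N"
    and \<eta>: "\<eta> \<in> Hom_indices A L" "x \<in> Hom_cell A \<eta>" and A: "abstract_complex A" "u \<in> A"
  shows "hom_point u N (\<lambda>e. \<Sum>i\<in>{i \<in> vertex_set L. c i = snd e}. x (fst e) i)"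
  unfolding hom_point_def
proof (intro conjI ballI impI)
  have V: "v \<in> vertex_set A" if "v \<in> u" for v using A that by (auto simp: vertex_set_def)
  have x: "0 \<le> x v i" "i \<notin> \<eta> v \<Longrightarrow> x v i = 0" "sum (x v) (\<eta> v) = 1" if "v \<in> u" for v i
    using \<eta>(2) V[OF that] by (auto simp: Hom_cell_def geometric_simplex_def PiE_iff)
  have sub: "\<eta> v \<subseteq> vertex_set L" if "v \<in> u" for v
    using \<eta>(1) V[OF that] by (auto simp: Hom_indices_def PiE_iff)
  show "0 \<le> (\<Sum>i\<in>{i \<in> vertex_set L. c i = snd e}. x (fst e) i)" if "e \<in> u \<times> N" for e
    using x(1) that by (intro sum_nonneg) auto
  show "\<exists>j\<in>N. 0 < (\<Sum>i\<in>{i \<in> vertex_set L. c i = snd (v, j)}. x (fst (v, j)) i)" if v: "v \<in> u" for v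
  proof -
    obtain i where i: "i \<in> \<eta> v" "x v i \<noteq> 0"
      using x(3)[OF v] by (metis sum.neutral zero_neq_one)
    then have iL: "i \<in> vertex_set L" and pos: "0 < x v i" using sub[OF v] x(1)[OF v, of i] by auto
    have "x v i \<le> (\<Sum>k\<in>{k \<in> vertex_set L. c k = c i}. x v k)"
      using L iL x(1)[OF v] by (intro member_le_sum) auto
    then show ?thesis using pos c(2)[OF iL] by (intro bexI[of _ "c i"]) auto
  qed
  show "(\<Sum>i\<in>{i \<in> vertex_set L. c i = snd (v, j)}. x (fst (v, j)) i) *
      (\<Sum>i\<in>{i \<in> vertex_set L. c i = snd (w, j)}. x (fst (w, j)) i) = 0"
    if vw: "v \<in> u" "w \<in> u" "v \<noteq> w" for v w j
  proof (rule ccontr)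
    assume "\<not> ?thesis"
    then have "(\<Sum>i\<in>{i \<in> vertex_set L. c i = j}. x v i) \<noteq> 0"
      "(\<Sum>i\<in>{i \<in> vertex_set L. c i = j}. x w i) \<noteq> 0" by auto
    then obtain i k where ik: "c i = j" "x v i \<noteq> 0" "c k = j" "x w k \<noteq> 0"
      by (metis (mono_tags, lifting) mem_Collect_eq sum.neutral)
    then have mem: "i \<in> \<eta> v" "k \<in> \<eta> w" using x(2) vw by blast+
    have edge: "{v, w} \<in> A" using A vw(1,2) by (auto simp: abstract_complex_def)
    have "\<eta> v \<inter> \<eta> w = {}"
      using \<eta>(1) edge V vw by (simp add: Hom_indices_def)
    \<comment> \<open>\<open>single\<close> ensures that \<open>{i, k}\<close> meets each of the two
      sets at most once, as the second Hom condition demands.\<close>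
    then have ne: "i \<noteq> k" and single: "i \<notin> \<eta> w" "k \<notin> \<eta> v" using mem by auto
    have "\<forall>\<rho>\<in>A. \<forall>T. T \<subseteq> (\<Union>v\<in>\<rho>. \<eta> v) \<and>
        (\<forall>v\<in>\<rho>. \<forall>x\<in>T \<inter> \<eta> v. \<forall>y\<in>T \<inter> \<eta> v. x = y) \<longrightarrow> T \<in> L"
      using \<eta>(1) by (simp add: Hom_indices_def)
    from bspec[OF this edge, THEN spec, of "{i, k}"]
    have "{i, k} \<in> L" using mem single by auto
    then have "inj_on c {i, k}" using c(1) unfolding nondegenerate_on_def by (rule bspec[rotated])
    then show False using ik(1,3) ne by auto
  qed
qed

section \<open>Two incompatible parities for the degree of \<open>q\<close>\<close>

theorem theorem2:
  fixes \<Gamma> :: "'a set set" and K :: "'b set set"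
    and \<omega> :: "'a \<Rightarrow> 'a" and \<sigma> :: "'a set"
    and d m :: nat
  assumes "finite \<Gamma>" and "Phi_complex d \<Gamma> \<omega> \<sigma>"
    and "finite K" and "pure_complex d K"
    and "even m"
    and "coind_ge (Hom_complex \<Gamma> K) (Hom_involution \<Gamma> \<omega>) m"
  shows "chromatic_number K \<ge> m + d + 2"
proof (rule ccontr)
  assume "\<not> ?thesis"
  then have few: "chromatic_number K \<le> m + d + 1" by simp
  let ?S = "topspace (nsphere m)"
  \<comment> \<open>Exactly \<open>m + d + 1\<close> colours, even if fewer suffice, so that the
    target sphere has dimension exactly \<open>m\<close>.\<close>
  define N where "N = {1..m + d + 1}"
  have N: "finite N" "card N = m + d + 1" by (simp_all add: N_def)
  have cK: "abstract_complex K" and c\<Gamma>: "abstract_complex \<Gamma>"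
    using assms(2,4) by (auto simp: Phi_complex_def pure_complex_def)
  have finK: "finite (vertex_set K)"
    using \<open>finite K\<close> cK by (auto simp: vertex_set_def abstract_complex_def)
  obtain c where c: "simplicial_vertex_map K (Pow {1..chromatic_number K}) c" "nondegenerate_on K c"
    by (rule colouring_exists[OF \<open>finite K\<close> cK])
  have cN: "c i \<in> N" if "i \<in> vertex_set K" for i
  proof -
    have "{i} \<in> K" using that cK by (auto simp: vertex_set_def abstract_complex_def)
    then have "c ` {i} \<in> Pow {1..chromatic_number K}"
      using c(1) unfolding simplicial_vertex_map_def by blast
    then show ?thesis using few by (simp add: N_def)
  qed

  have \<omega>V: "\<omega> v \<in> vertex_set \<Gamma>" if "v \<in> vertex_set \<Gamma>" for v
    using assms(2) that
    by (auto simp: Phi_complex_def simplicial_involution_def simplicial_vertex_map_def vertex_set_def)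
  have \<omega>\<omega>: "\<omega> (\<omega> v) = v" if "v \<in> vertex_set \<Gamma>" for v
    using assms(2) that by (simp add: Phi_complex_def simplicial_involution_def)
  have \<sigma>: "\<sigma> \<in> \<Gamma>" "finite \<sigma>" "card \<sigma> = d + 1" "\<omega> ` \<sigma> = \<sigma>"
    using assms(2) by (simp_all add: Phi_complex_def simplices_def)
  have \<sigma>V: "v \<in> vertex_set \<Gamma>" if "v \<in> \<sigma>" for v using that \<sigma>(1) by (auto simp: vertex_set_def)
  have proj: "projectivity d \<Gamma> \<sigma> \<sigma> (restrict \<omega> \<sigma>)" and nontriv: "restrict \<omega> \<sigma> \<noteq> (\<lambda>v\<in>\<sigma>. v)"
    using assms(2) by (simp_all add: Phi_complex_def projectivity_group_def BijGroup_def)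
  obtain a where a: "a \<in> \<sigma>" "\<omega> a \<noteq> a"
    using nontriv by (metis restrict_ext)

  obtain f where f: "continuous_map (nsphere m) (Hom_complex \<Gamma> K) f"
    and f_anti: "\<And>x. x \<in> ?S \<Longrightarrow> f (\<lambda>i. - x i) = Hom_involution \<Gamma> \<omega> (f x)"
    using assms(6) unfolding coind_ge_def by blast
  define X where "X = (\<lambda>x v j. \<Sum>i\<in>{i \<in> vertex_set K. c i = j}. f x v i)"
  have X_anti: "X (\<lambda>i. - x i) v j = X x (\<omega> v) j" if "x \<in> ?S" "v \<in> vertex_set \<Gamma>" for x v j
    using f_anti[OF that(1)] that(2) by (simp add: X_def Hom_involution_def)
  have f_coord: "continuous_map (nsphere m) euclideanreal (\<lambda>x. f x v i)" if v: "v \<in> vertex_set \<Gamma>" for v i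
  proof -
    have "continuous_map (nsphere m)
        (product_topology (\<lambda>v. geometric_simplex_topology (vertex_set K)) (vertex_set \<Gamma>)) f"
      using f unfolding Hom_complex_def by (rule continuous_map_into_fulltopology)
    then have "continuous_map (nsphere m) (geometric_simplex_topology (vertex_set K)) (\<lambda>x. f x v)"
      using v by (rule continuous_map_product_then_coordinatewise(1))
    then have "continuous_map (nsphere m) (powertop_real UNIV) (\<lambda>x. f x v)"
      unfolding geometric_simplex_topology_def by (rule continuous_map_into_fulltopology)
    then show ?thesis by (simp add: continuous_map_componentwise_UNIV)
  qed
  have X_cont: "continuous_map (nsphere m) euclideanreal (\<lambda>x. X x v j)" if "v \<in> vertex_set \<Gamma>" for v j
    unfolding X_def using finK f_coord[OF that] by (intro continuous_map_sum) auto
  have X_point: "hom_point u N (\<lambda>e. X x (fst e) (snd e))" if x: "x \<in> ?S" and u: "u \<in> \<Gamma>" for x u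
  proof -
    have "f x \<in> topspace (Hom_complex \<Gamma> K)"
      using continuous_map_image_subset_topspace[OF f] x by blast
    then obtain \<eta> where "\<eta> \<in> Hom_indices \<Gamma> K" "f x \<in> Hom_cell \<Gamma> \<eta>"
      by (auto simp: Hom_complex_def)
    then show ?thesis
      unfolding X_def by (intro hom_point_Hom_cell[OF finK c(2) cN _ _ c\<Gamma> u])
  qed

  define h where "h = (\<lambda>x i. hom_coordinate a (\<omega> a) \<sigma> N (\<lambda>e. X x (fst e) (snd e)) (i + d + 1))"
  have h_cont: "continuous_map (nsphere m) euclideanreal (\<lambda>x. h x i)" for i
    unfolding h_def by (rule continuous_map_hom_coordinate[OF \<sigma>(2) N(1)])
      (use X_cont[OF \<sigma>V] in \<open>simp add: mem_Times_iff\<close>)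
  have h_nz: "\<exists>i\<le>m. h x i \<noteq> 0" if x: "x \<in> ?S" for x
  proof -
    obtain k where k: "d + 1 \<le> k" "k \<le> m + d + 1"
      "hom_coordinate a (\<omega> a) \<sigma> N (\<lambda>e. X x (fst e) (snd e)) k \<noteq> 0"
      by (rule hom_coordinate_nonzero[OF \<sigma>(2) N(1) X_point[OF x \<sigma>(1)], unfolded \<sigma>(3) N(2)]) (rule that)
    then show ?thesis by (intro exI[of _ "k - (d + 1)"]) (simp add: h_def)
  qed
  \<comment> \<open>Used twice: with equivariance of \<open>f\<close> it makes \<open>h\<close> odd,
    and with parallel transport it compares \<open>q\<close> with its negative.\<close>
  have inv: "hom_coordinate a (\<omega> a) \<sigma> N (\<lambda>e. X x (\<omega> (fst e)) (snd e)) k =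
      - hom_coordinate a (\<omega> a) \<sigma> N (\<lambda>e. X x (fst e) (snd e)) k" for x k
  proof -
    have "\<omega> v \<in> \<sigma> \<and> \<omega> (\<omega> v) = v" if "v \<in> \<sigma>" for v using \<sigma>(4) \<omega>\<omega>[OF \<sigma>V[OF that]] that by auto
    from hom_coordinate_involution[where M = "\<lambda>e. X x (fst e) (snd e)", OF this a]
    show ?thesis by simp
  qed
  have h_odd: "h (\<lambda>i. - x i) = (\<lambda>i. - h x i)" if x: "x \<in> ?S" for x
  proof
    fix i
    have "h (\<lambda>i. - x i) i = hom_coordinate a (\<omega> a) \<sigma> N (\<lambda>e. X x (\<omega> (fst e)) (snd e)) (i + d + 1)"
      unfolding h_def by (rule hom_coordinate_cong) (use X_anti[OF x] \<sigma>V in auto)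
    then show "h (\<lambda>i. - x i) i = - h x i" by (simp add: inv h_def)
  qed
  define q where "q = (\<lambda>x. normalized m (h x))"
  have q: "continuous_map (nsphere m) (nsphere m) q"
    unfolding q_def by (rule continuous_map_normalized[OF h_cont h_nz])
  have "odd (Brouwer_degree2 m q)"
    by (rule odd_Brouwer_degree2_odd_map[OF q]) (simp add: q_def h_odd normalized_uminus)
  \<comment> \<open>Transport along the projectivity \<open>restrict \<omega> \<sigma>\<close>
    preserves the degree, while by \<open>inv\<close> it replaces \<open>h\<close> by its
    negative.\<close>
  moreover have "Brouwer_degree2 m ((\<lambda>x i. - x i) \<circ> q) = Brouwer_degree2 m q"
  proof -
    have "hom_coordinate a (\<omega> a) \<sigma> N (\<lambda>e. X x (restrict \<omega> \<sigma> (fst e)) (snd e)) k =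
        hom_coordinate a (\<omega> a) \<sigma> N (\<lambda>e. X x (\<omega> (fst e)) (snd e)) k" for x k
      by (rule hom_coordinate_cong) auto
    then have "(\<lambda>i. hom_coordinate a (\<omega> a) \<sigma> N (\<lambda>e. X x (restrict \<omega> \<sigma> (fst e)) (snd e)) (i + d + 1)) =
        (\<lambda>i. - h x i)" for x
      by (simp add: inv h_def)
    with Brouwer_degree2_projectivity[OF proj N X_cont X_point, of a "\<omega> a"]
    show ?thesis by (simp add: q_def h_def normalized_uminus o_def)
  qed
  then have "- Brouwer_degree2 m q = Brouwer_degree2 m q"
    by (simp add: Brouwer_degree2_compose[OF q continuous_map_nsphere_antipodal]
        Brouwer_degree2_antipodal[OF \<open>even m\<close>])
  ultimately show False by simp
qed

end
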